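(* Let $k$ be a field of characteristic zero, let $R = k[x_1,x_2,x_3,x_4,x_5]$, let $d \ge 1$ and $e \ge 1$ be integers, let $L \in R$ be a general linear form, and let $I = \langle x_1^{d}, x_2^{d}, x_3^{d}, x_4^{d}, x_5^{d}, L^{d+e} \rangle$. Then: (i) If $d$ is odd, then $R/I$ has the WLP if and only if $e \ge \frac{3d-5}{2}$. (ii) If $d$ is even, then $R/I$ has the WLP if and only if $e \ge \frac{3d-8}{2}$.
   Context: "General linear form" means that the assertion holds for all linear forms whose coefficient vector lies in some nonempty Zariski-open subset of the space of linear forms $[R]_1$. A standard graded artinian $k$-algebra $A = R/I$ has the Weak Lefschetz Property (WLP) if, for a general linear form $\ell \in R$, the multiplication map $\times \ell : [A]_{t} \to [A]_{t+1}$ has maximal rank (i.e. is injective or surjective) for every integer $t$. *)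

theory Defs
  imports
    Complex_Main
    "HOL-Library.Poly_Mapping"
    "HOL-Library.Numeral_Type"
begin

text \<open>
  The polynomial ring \<open>k[x\<^sub>i : i \<in> 'n]\<close> over a finite index type: a polynomial is a finitely
  supported map from exponent vectors to coefficients, with the convolution product of
  \<open>HOL-Library.Poly_Mapping\<close>. The index type \<open>5\<close> gives \<open>k[x\<^sub>1,\<dots>,x\<^sub>5]\<close>.
\<close>

type_synonym ('n, 'a) mpoly = "('n \<Rightarrow>\<^sub>0 nat) \<Rightarrow>\<^sub>0 'a"

definition Var :: "'n \<Rightarrow> ('n, 'a::comm_ring_1) mpoly" where
  "Var i = Poly_Mapping.single (Poly_Mapping.single i 1) 1"

definition Const :: "'a \<Rightarrow> ('n, 'a::comm_ring_1) mpoly" where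
  "Const a = Poly_Mapping.single 0 a"

definition eval_poly :: "('n::finite \<Rightarrow> 'a) \<Rightarrow> ('n, 'a::comm_ring_1) mpoly \<Rightarrow> 'a" where
  "eval_poly c p = (\<Sum>m\<in>Poly_Mapping.keys p. Poly_Mapping.lookup p m * (\<Prod>i\<in>UNIV. c i ^ Poly_Mapping.lookup m i))"

definition mono_deg :: "('n::finite \<Rightarrow>\<^sub>0 nat) \<Rightarrow> nat" where
  "mono_deg m = (\<Sum>i\<in>UNIV. Poly_Mapping.lookup m i)"

text \<open>The graded component \<open>[R]\<^sub>t\<close>; it is zero for negative \<open>t\<close>.\<close>

definition homog :: "int \<Rightarrow> ('n::finite, 'a::comm_ring_1) mpoly set" where
  "homog t = {p. \<forall>m\<in>Poly_Mapping.keys p. int (mono_deg m) = t}"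

definition linear_form :: "('n::finite \<Rightarrow> 'a) \<Rightarrow> ('n, 'a::comm_ring_1) mpoly" where
  "linear_form c = (\<Sum>i\<in>UNIV. Const (c i) * Var i)"

definition zariski_open :: "('n::finite \<Rightarrow> 'a::field) set \<Rightarrow> bool" where
  "zariski_open U \<longleftrightarrow> (\<exists>S :: ('n, 'a) mpoly set. U = - {c. \<forall>p\<in>S. eval_poly c p = 0})"

definition for_general_linear_form :: "(('n::finite, 'a::field) mpoly \<Rightarrow> bool) \<Rightarrow> bool" where
  "for_general_linear_form P \<longleftrightarrow>
     (\<exists>U. zariski_open U \<and> U \<noteq> {} \<and> (\<forall>c\<in>U. P (linear_form c)))"

text \<open>
  Ideals are the submodules of a ring regarded as a module over itself, so the ideal generated
  by a set is its span.
\<close>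

lemma module_self: "module ((*) :: 'a::comm_ring_1 \<Rightarrow> 'a \<Rightarrow> 'a)"
  by unfold_locales (simp_all add: algebra_simps)

definition ideal_gen :: "'a::comm_ring_1 set \<Rightarrow> 'a set" where
  "ideal_gen S = module.span (*) S"

definition residue_class :: "'a::comm_ring_1 set \<Rightarrow> 'a \<Rightarrow> 'a set" where
  "residue_class I f = {g. g - f \<in> I}"

text \<open>
  For a homogeneous ideal \<open>I\<close>, the component \<open>[R/I]\<^sub>t\<close> consists of the classes of the elements
  of \<open>[R]\<^sub>t\<close>.
\<close>

definition quot_component :: "('n::finite, 'a::comm_ring_1) mpoly set \<Rightarrow> int \<Rightarrow> ('n, 'a) mpoly set set" where
  "quot_component I t = residue_class I ` homog t"

definition quot_mult :: "'a::comm_ring_1 set \<Rightarrow> 'a \<Rightarrow> 'a set \<Rightarrow> 'a set" where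
  "quot_mult I l C = (\<Union>f\<in>C. residue_class I (l * f))"

lemma quot_mult_residue_class:
  assumes I: "module.subspace (*) I"
  shows "quot_mult I l (residue_class I f) = residue_class I (l * f)"
proof (intro equalityI subsetI)
  interpret module "(*) :: 'a \<Rightarrow> 'a \<Rightarrow> 'a" by (rule module_self)
  {
    fix h assume "h \<in> quot_mult I l (residue_class I f)"
    then obtain g where "g - f \<in> I" "h - l * g \<in> I"
      by (auto simp: quot_mult_def residue_class_def)
    then have "(h - l * g) + l * (g - f) \<in> I"
      using I by (intro subspace_add subspace_scale)
    then show "h \<in> residue_class I (l * f)"
      by (simp add: residue_class_def algebra_simps)
  next
    fix h assume "h \<in> residue_class I (l * f)"
    moreover have "f \<in> residue_class I f"
      using subspace_0[OF I] by (simp add: residue_class_def)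
    ultimately show "h \<in> quot_mult I l (residue_class I f)"
      by (auto simp: quot_mult_def)
  }
qed

text \<open>The weak Lefschetz property of \<open>R/I\<close>, for a homogeneous ideal \<open>I\<close> with artinian quotient.\<close>

definition has_WLP :: "('n::finite, 'a::field) mpoly set \<Rightarrow> bool" where
  "has_WLP I \<longleftrightarrow> for_general_linear_form (\<lambda>l. \<forall>t.
     inj_on (quot_mult I l) (quot_component I t) \<or>
     quot_mult I l ` quot_component I t = quot_component I (t + 1))"

end

theory Submission
  imports Defs "HOL-Computational_Algebra.Formal_Power_Series" "HOL-Computational_Algebra.Polynomial"
begin

text \<open>
  Write \<open>s = 5 (d - 1)\<close>, \<open>m = d + e\<close>, \<open>L = \<Sum> b\<^sub>i x\<^sub>i\<close>, and let \<open>\<ell> = \<Sum> c\<^sub>i x\<^sub>i\<close> be the form that tests the weak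
  Lefschetz property. Let \<open>A\<close> be the quotient of the polynomial ring by the \<open>d\<close>-th powers of the variables and
  \<open>B = A / \<ell> A\<close>. If all \<open>c\<^sub>i\<close> are nonzero, then \<open>\<ell>\<close> acts on \<open>A\<close> as the raising operator of an
  \<open>sl\<^sub>2\<close>-representation, so powers of \<open>\<ell>\<close> are injective below the middle degree \<open>s / 2\<close>
  (\<open>strong_lefschetz_injective\<close>) and \<open>B\<close> vanishes above it (\<open>lefschetz_surjective\<close>). Hence multiplication by
  \<open>\<ell>\<close> on \<open>A / L\<^sup>m A\<close> is surjective above the middle, and below it the question is whether
  \<open>L\<^sup>m : B\<^sub>q\<^sub>-\<^sub>m \<rightarrow> B\<^sub>q\<close> is injective (\<open>max_rankI\<close>).

  Elements of \<open>B\<close> are detected by pairing them with polynomials \<open>F\<close> of degree at most \<open>d - 1\<close> in each variable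
  that are annihilated by the derivative along \<open>c\<close>. In the coordinates \<open>z\<^sub>i = X\<^sub>i / c\<^sub>i\<close> these are the
  translation-invariant polynomials in five points of the line, and multiplication by \<open>L\<close> becomes the derivative in the
  direction of the point \<open>a\<^sub>i = b\<^sub>i / c\<^sub>i\<close>. All that is required of \<open>\<ell>\<close> is that the \<open>a\<^sub>i\<close> are distinct and
  that no \<open>b\<^sub>i\<close> or \<open>c\<^sub>i\<close> is zero.

  If \<open>m\<close> is as large as the bounds say, then only \<open>q = m\<close> and \<open>q = m + 1\<close> can occur below the middle, and
  products of differences \<open>z\<^sub>i - z\<^sub>j\<close> along pentagons show the injectivity
  (\<open>power_not_in_ideal_odd\<close>, \<open>linear_times_power_in_ideal_even\<close>).

  If \<open>m\<close> is smaller, then the least \<open>q\<close> with \<open>3 q \<ge> s + m + 1\<close> satisfies \<open>2 q \<le> s\<close>, and maximal rank fails in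
  degree \<open>q\<close>. The points \<open>z\<^sub>i = 1 / (\<tau> - a\<^sub>i)\<close>, up to translation and scaling, trace a twisted cubic through \<open>a\<close>.
  On it the forms \<open>F\<close> of degree \<open>q\<close> become, after multiplication by \<open>\<Prod> (\<tau> - a\<^sub>i)\<^sup>d\<^sup>-\<^sup>1\<close>, polynomials in
  \<open>\<tau>\<close> with only \<open>s - 2 q + 1\<close> coefficients. Expanding at \<open>a\<close> further than that gives a linear relation between
  the derivatives of order \<open>q - m\<close> at \<open>a\<close> that holds for all \<open>F\<close>, that is, an element of the kernel of \<open>L\<^sup>m\<close>
  on \<open>B\<^sub>q\<^sub>-\<^sub>m\<close> (\<open>twisted_cubic_relation\<close>). An explicit product of planes and conics through \<open>a\<close> and of a
  difference \<open>z\<^sub>i - z\<^sub>j\<close> shows that \<open>L\<^sup>m\<close> is not surjective there either (\<open>cokernel_nonzero\<close>).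
\<close>

section \<open>Polynomials as coefficient functions\<close>

abbreviation coeff_at :: "('n, 'a::comm_ring_1) mpoly \<Rightarrow> ('n \<Rightarrow>\<^sub>0 nat) \<Rightarrow> 'a" where
  "coeff_at \<equiv> Poly_Mapping.lookup"

abbreviation unit_exp :: "'n \<Rightarrow> ('n \<Rightarrow>\<^sub>0 nat)" where
  "unit_exp i \<equiv> Poly_Mapping.single i (Suc 0)"

lemma Const_0 [simp]: "Const 0 = 0"
  by (simp add: Const_def)

lemma Const_1 [simp]: "Const 1 = 1"
  by (simp add: Const_def)

lemma Const_add: "Const (a + b) = Const a + Const b"
  by (simp add: Const_def single_add)

lemma Const_mult: "Const (a * b) = Const a * Const b"
  by (simp add: Const_def mult_single)

lemma Const_diff: "Const (a - b) = Const a - Const b"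
  by (simp add: Const_def single_diff)

lemma Const_of_nat: "Const (of_nat n) = of_nat n"
  by (simp add: Const_def)

lemma Const_of_int: "Const (of_int n) = of_int n"
  by (simp add: Const_def)

lemma coeff_at_Const: "coeff_at (Const a) k = (if k = 0 then a else 0)"
  by (simp add: Const_def lookup_single when_def)

lemma coeff_at_Const_times [simp]: "coeff_at (Const a * p) k = a * coeff_at p k"
  by (simp add: Const_def lookup_mult lookup_single when_mult)

lemma coeff_at_Var_times: "coeff_at (Var i * p) k = (\<Sum>q. coeff_at p q when k = unit_exp i + q)"
  by (simp add: Var_def lookup_mult lookup_single when_mult)

lemma coeff_at_Var_times_shift [simp]: "coeff_at (Var i * p) (unit_exp i + k) = coeff_at p k"
  by (simp add: coeff_at_Var_times)

lemma coeff_at_Var_times_0: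
  assumes "Poly_Mapping.lookup k i = 0"
  shows "coeff_at (Var i * p) k = 0"
proof -
  have "k \<noteq> unit_exp i + q" for q
    using assms by (metis Zero_not_Suc add_is_0 lookup_add lookup_single_eq)
  then show ?thesis by (simp add: coeff_at_Var_times)
qed

lemma exponent_split:
  assumes "Poly_Mapping.lookup k i \<noteq> 0"
  obtains k' where "k = unit_exp i + k'"
proof
  show "k = unit_exp i + (k - unit_exp i)"
    using assms by (intro poly_mapping_eqI) (auto simp: lookup_add lookup_minus lookup_single when_def)
qed

lemma mono_deg_add: "mono_deg (k + l) = mono_deg k + mono_deg l"
  by (simp add: mono_deg_def lookup_add sum.distrib)

lemma mono_deg_unit [simp]: "mono_deg (unit_exp i) = 1"
  by (simp add: mono_deg_def lookup_single when_def)

lemma mono_deg_0_iff: "mono_deg k = 0 \<longleftrightarrow> k = 0"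
  by (auto simp: mono_deg_def intro: poly_mapping_eqI)

lemma sum_of_monomials:
  "p = (\<Sum>m\<in>Poly_Mapping.keys p. Poly_Mapping.single m (Poly_Mapping.lookup p m))"
proof (rule poly_mapping_eqI)
  fix k
  show "Poly_Mapping.lookup p k =
    Poly_Mapping.lookup (\<Sum>m\<in>Poly_Mapping.keys p. Poly_Mapping.single m (Poly_Mapping.lookup p m)) k"
    by (cases "k \<in> Poly_Mapping.keys p")
       (auto simp: lookup_sum lookup_single when_def in_keys_iff sum.delta)
qed

lemma single_unit_add: "Poly_Mapping.single (unit_exp i + k) a = Var i * Poly_Mapping.single k a"
  by (simp add: Var_def mult_single)

text \<open>
  Every additive property of polynomials that survives multiplication by a variable can be proved
  without touching the convolution product: the Leibniz rule, the multiplicativity of evaluation and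
  the ideal property of \<open>pow_ideal\<close> below are all obtained from this rule.
\<close>

lemma mpoly_induct [case_names Const Var add]:
  fixes p :: "('n::finite, 'a::comm_ring_1) mpoly"
  assumes const: "\<And>a. P (Const a)"
    and var: "\<And>i p. P p \<Longrightarrow> P (Var i * p)"
    and add: "\<And>p q. P p \<Longrightarrow> P q \<Longrightarrow> P (p + q)"
  shows "P p"
proof -
  have mono: "P (Poly_Mapping.single m a)" for m a
  proof (induction "mono_deg m" arbitrary: m)
    case 0
    then show ?case using const[of a] by (simp add: mono_deg_0_iff Const_def)
  next
    case (Suc n)
    then have "m \<noteq> 0" by (auto simp: mono_deg_def)
    then obtain i where "Poly_Mapping.lookup m i \<noteq> 0"
      by (metis lookup_zero poly_mapping_eqI)
    then obtain k where k: "m = unit_exp i + k" by (rule exponent_split)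
    with Suc(2) have "n = mono_deg k" by (simp add: mono_deg_add)
    from Suc(1)[OF this] show ?case
      unfolding k single_unit_add by (rule var)
  qed
  have "P (\<Sum>m\<in>A. Poly_Mapping.single m (Poly_Mapping.lookup p m))" if "finite A" for A
    using that
  proof (induction A rule: finite_induct)
    case empty
    show ?case using const[of 0] by simp
  next
    case (insert x F)
    then show ?case by (simp add: add mono)
  qed
  from this[of "Poly_Mapping.keys p"] show ?thesis
    by (simp flip: sum_of_monomials)
qed

section \<open>Evaluation and Zariski-open sets\<close>

lemma eval_poly_superset:
  assumes "finite A" "Poly_Mapping.keys p \<subseteq> A"
  shows "eval_poly c p = (\<Sum>m\<in>A. coeff_at p m * (\<Prod>i\<in>UNIV. c i ^ Poly_Mapping.lookup m i))"
  unfolding eval_poly_def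
  by (rule sum.mono_neutral_left) (use assms in \<open>auto simp: in_keys_iff\<close>)

lemma eval_poly_add: "eval_poly c (p + q) = eval_poly c p + eval_poly c q"
proof -
  let ?A = "Poly_Mapping.keys p \<union> Poly_Mapping.keys q"
  have "Poly_Mapping.keys (p + q) \<subseteq> ?A" by (rule keys_add)
  then show ?thesis
    by (simp add: eval_poly_superset[of ?A] lookup_add algebra_simps sum.distrib)
qed

lemma eval_poly_Const [simp]: "eval_poly c (Const a) = a"
  by (simp add: eval_poly_superset[of "{0}"] Const_def)

lemma keys_Var_times: "Poly_Mapping.keys (Var i * p) = (+) (unit_exp i) ` Poly_Mapping.keys p"
proof (intro set_eqI iffI)
  fix k assume k: "k \<in> Poly_Mapping.keys (Var i * p)"
  then have "Poly_Mapping.lookup k i \<noteq> 0"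
    by (metis coeff_at_Var_times_0 in_keys_iff)
  then obtain k' where "k = unit_exp i + k'" by (rule exponent_split)
  with k show "k \<in> (+) (unit_exp i) ` Poly_Mapping.keys p"
    by (auto simp: in_keys_iff)
qed (auto simp: in_keys_iff)

lemma eval_poly_Var_times: "eval_poly c (Var i * p) = c i * eval_poly c p"
proof -
  have "(\<Prod>j\<in>UNIV. c j ^ Poly_Mapping.lookup (unit_exp i + m) j)
      = c i * (\<Prod>j\<in>UNIV. c j ^ Poly_Mapping.lookup m j)" for m
    by (simp add: lookup_add power_add prod.distrib)
       (simp add: lookup_single when_def if_distrib[of "\<lambda>n. _ ^ n"] prod.delta cong: if_cong)
  then show ?thesis
    by (simp add: eval_poly_def keys_Var_times sum.reindex sum_distrib_left mult.left_commute)
qed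

lemma eval_poly_mult: "eval_poly c (p * q) = eval_poly c p * eval_poly c q"
proof (induction p rule: mpoly_induct)
  case (Const a)
  have "Poly_Mapping.keys (Const a * q) \<subseteq> Poly_Mapping.keys q"
    by (auto simp: in_keys_iff)
  then show ?case
    by (simp add: eval_poly_superset[of "Poly_Mapping.keys q"] sum_distrib_left mult.assoc)
qed (simp_all add: eval_poly_add eval_poly_Var_times distrib_right mult.assoc)

lemma eval_poly_prod: "eval_poly c (\<Prod>x\<in>A. f x) = (\<Prod>x\<in>A. eval_poly c (f x))"
  using eval_poly_Const[of c 1]
  by (induction A rule: infinite_finite_induct) (simp_all add: eval_poly_mult)

lemma eval_poly_Var [simp]: "eval_poly c (Var i) = c i"
  using eval_poly_Var_times[of c i 1] eval_poly_Const[of c 1] by simp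

lemma eval_poly_diff: "eval_poly c (p - q) = eval_poly c p - eval_poly c q"
  using eval_poly_add[of c "p - q" q] by simp

lemma eval_poly_on_line:
  fixes p :: "('n::finite, 'a::field) mpoly"
  shows "\<exists>P. \<forall>t. poly P t = eval_poly (\<lambda>i. c i + t * v i) p"
proof
  show "\<forall>t. poly (\<Sum>m\<in>Poly_Mapping.keys p. [:coeff_at p m:] *
      (\<Prod>i\<in>UNIV. [:c i, v i:] ^ Poly_Mapping.lookup m i)) t = eval_poly (\<lambda>i. c i + t * v i) p"
    by (simp add: eval_poly_def poly_sum poly_prod)
qed

text \<open>
  Affine space over an infinite field is irreducible. On the line joining a point of one set to a
  point of the other, each set contains the complement of the zeros of a nonzero polynomial in one
  variable, and finitely many zeros do not exhaust the field.
\<close>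

lemma nonempty_zariski_open_Int:
  fixes U V :: "('n::finite \<Rightarrow> 'a::field_char_0) set"
  assumes "zariski_open U" "zariski_open V" "U \<noteq> {}" "V \<noteq> {}"
  shows "U \<inter> V \<noteq> {}"
proof -
  obtain S T where S: "U = - {c. \<forall>p\<in>S. eval_poly c p = 0}"
    and T: "V = - {c. \<forall>p\<in>T. eval_poly c p = 0}"
    using assms(1,2) by (auto simp: zariski_open_def)
  obtain c p where p: "p \<in> S" "eval_poly c p \<noteq> 0" using assms(3) S by auto
  obtain c' q where q: "q \<in> T" "eval_poly c' q \<noteq> 0" using assms(4) T by auto
  let ?x = "\<lambda>t i. c i + t * (c' i - c i)"
  obtain P where P: "\<And>t. poly P t = eval_poly (?x t) p"
    using eval_poly_on_line[of c "\<lambda>i. c' i - c i" p] by blast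
  obtain Q where Q: "\<And>t. poly Q t = eval_poly (?x t) q"
    using eval_poly_on_line[of c "\<lambda>i. c' i - c i" q] by blast
  have "poly P 0 \<noteq> 0" "poly Q 1 \<noteq> 0" using p q by (simp_all add: P Q)
  then have "P * Q \<noteq> 0" by auto
  then have "finite {t. poly (P * Q) t = 0}" by (rule poly_roots_finite)
  then obtain t where "poly (P * Q) t \<noteq> 0"
    by (metis (mono_tags, lifting) UNIV_eq_I infinite_UNIV_char_0 mem_Collect_eq)
  then have "?x t \<in> U \<inter> V" using p(1) q(1) by (auto simp: S T P Q)
  then show ?thesis by blast
qed

lemma zariski_open_nonvanishing: "zariski_open {c. eval_poly c p \<noteq> 0}"
  unfolding zariski_open_def by (intro exI[of _ "{p}"]) auto

section \<open>Homogeneous components\<close>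

lift_definition hom_part :: "nat \<Rightarrow> ('n::finite, 'a::comm_ring_1) mpoly \<Rightarrow> ('n, 'a) mpoly" is
  "\<lambda>t f m. if mono_deg m = t then f m else 0"
  by (rule rev_finite_subset, assumption) auto

lemma coeff_at_hom_part: "coeff_at (hom_part t p) m = (if mono_deg m = t then coeff_at p m else 0)"
  by (simp add: hom_part.rep_eq)

lemma hom_part_0 [simp]: "hom_part t 0 = 0"
  and hom_part_add: "hom_part t (p + q) = hom_part t p + hom_part t q"
  and hom_part_diff: "hom_part t (p - q) = hom_part t p - hom_part t q"
  and hom_part_Const_times: "hom_part t (Const a * p) = Const a * hom_part t p"
  by (auto intro!: poly_mapping_eqI simp: coeff_at_hom_part lookup_add lookup_minus)

lemma hom_part_sum: "hom_part t (\<Sum>i\<in>A. f i) = (\<Sum>i\<in>A. hom_part t (f i))"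
  by (induction A rule: infinite_finite_induct) (simp_all add: hom_part_add)

lemma hom_part_Var_times: "hom_part (Suc t) (Var i * p) = Var i * hom_part t p"
proof (rule poly_mapping_eqI)
  fix k
  show "coeff_at (hom_part (Suc t) (Var i * p)) k = coeff_at (Var i * hom_part t p) k"
  proof (cases "Poly_Mapping.lookup k i = 0")
    case True
    then show ?thesis by (simp add: coeff_at_hom_part coeff_at_Var_times_0)
  next
    case False
    then obtain k' where "k = unit_exp i + k'" by (rule exponent_split)
    then show ?thesis by (simp add: coeff_at_hom_part mono_deg_add)
  qed
qed

lemma hom_part_0_Var_times: "hom_part 0 (Var i * p) = 0"
  by (intro poly_mapping_eqI) (auto simp: coeff_at_hom_part coeff_at_Var_times_0 mono_deg_0_iff)

lemma linear_form_times: "linear_form c * p = (\<Sum>i\<in>UNIV. Const (c i) * (Var i * p))"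
  by (simp add: linear_form_def sum_distrib_right mult.assoc)

lemma hom_part_linear_form_times: "hom_part (Suc t) (linear_form c * p) = linear_form c * hom_part t p"
  by (simp add: linear_form_times hom_part_sum hom_part_Const_times hom_part_Var_times)

lemma hom_part_0_linear_form_times: "hom_part 0 (linear_form c * p) = 0"
  by (simp add: linear_form_times hom_part_sum hom_part_Const_times hom_part_0_Var_times)

lemma hom_part_power_times: "hom_part (t + n) (linear_form c ^ n * p) = linear_form c ^ n * hom_part t p"
  by (induction n) (simp_all add: hom_part_linear_form_times mult.assoc)

lemma hom_part_power_times_below:
  assumes "t < n"
  shows "hom_part t (linear_form c ^ n * p) = 0"
  using assms
proof (induction n arbitrary: t)
  case (Suc n)
  then show ?case
    by (cases t) (simp_all add: hom_part_linear_form_times hom_part_0_linear_form_times mult.assoc)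
qed simp

lemma hom_part_idem: "hom_part t (hom_part t p) = hom_part t p"
  by (intro poly_mapping_eqI) (simp add: coeff_at_hom_part)

lemma homog_iff_hom_part: "p \<in> homog (int t) \<longleftrightarrow> hom_part t p = p"
proof
  assume "p \<in> homog (int t)"
  then show "hom_part t p = p"
    by (intro poly_mapping_eqI) (auto simp: coeff_at_hom_part homog_def in_keys_iff)
next
  assume "hom_part t p = p"
  then show "p \<in> homog (int t)"
    by (auto simp: homog_def in_keys_iff) (metis coeff_at_hom_part)
qed

lemma homog_neg: "t < 0 \<Longrightarrow> homog t = {0}"
  by (auto simp: homog_def in_keys_iff intro!: poly_mapping_eqI)

lemma hom_part_linear_form_power: "hom_part n (linear_form c ^ n) = linear_form (c :: 'n::finite \<Rightarrow> 'a::comm_ring_1) ^ n"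
proof -
  have "hom_part 0 1 = (1 :: ('n, 'a) mpoly)"
    by (intro poly_mapping_eqI) (simp add: coeff_at_hom_part lookup_one when_def mono_deg_0_iff)
  then show ?thesis using hom_part_power_times[of 0 n c 1] by simp
qed

section \<open>Partial derivatives\<close>

text \<open>
  The coefficientwise formula is the derivative of monomials; describing it through coefficients makes
  the compatibility with degrees and with \<open>pow_ideal\<close> immediate.
\<close>

lift_definition partial :: "'n \<Rightarrow> ('n, 'a::comm_ring_1) mpoly \<Rightarrow> ('n, 'a) mpoly" is
  "\<lambda>i f k. of_nat (Suc (Poly_Mapping.lookup k i)) * f (unit_exp i + k)"
proof -
  fix i :: 'n and f :: "('n \<Rightarrow>\<^sub>0 nat) \<Rightarrow> 'a"
  assume "finite {m. f m \<noteq> 0}"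
  then have "finite ((\<lambda>k. unit_exp i + k) -` {m. f m \<noteq> 0})"
    by (rule finite_vimageI) (simp add: inj_on_def)
  then show "finite {k. of_nat (Suc (Poly_Mapping.lookup k i)) * f (unit_exp i + k) \<noteq> 0}"
    by (rule rev_finite_subset) auto
qed

lemma coeff_at_partial:
  "coeff_at (partial i p) k = of_nat (Suc (Poly_Mapping.lookup k i)) * coeff_at p (unit_exp i + k)"
  by (simp add: partial.rep_eq)

lemma partial_add: "partial i (p + q) = partial i p + partial i q"
  and partial_diff: "partial i (p - q) = partial i p - partial i q"
  and partial_0 [simp]: "partial i 0 = 0"
  and partial_Const_times [simp]: "partial i (Const a * p) = Const a * partial i p"
  by (auto intro!: poly_mapping_eqI simp: coeff_at_partial lookup_add lookup_minus algebra_simps)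
     (simp_all add: coeff_at_partial algebra_simps flip: coeff_at_Const_times)

lemma partial_sum: "partial i (\<Sum>j\<in>A. f j) = (\<Sum>j\<in>A. partial i (f j))"
  by (induction A rule: infinite_finite_induct) (simp_all add: partial_add)

lemma unit_exp_add_neq_0: "unit_exp i + k \<noteq> 0"
  by (metis add_is_0 lookup_add lookup_single_eq lookup_zero Zero_not_Suc)

lemma partial_Const [simp]: "partial i (Const a) = 0"
  by (intro poly_mapping_eqI) (simp add: coeff_at_partial coeff_at_Const unit_exp_add_neq_0)

lemma partial_1 [simp]: "partial i 1 = 0"
  using partial_Const[of i 1] by (simp del: partial_Const)

lemma partial_Var_times: "partial i (Var j * p) = (if i = j then p else 0) + Var j * partial i p"
proof (rule poly_mapping_eqI)
  fix k
  show "coeff_at (partial i (Var j * p)) k = coeff_at ((if i = j then p else 0) + Var j * partial i p) k"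
  proof (cases "Poly_Mapping.lookup k j = 0")
    case True
    then show ?thesis
      by (simp add: coeff_at_partial lookup_add coeff_at_Var_times_0 lookup_single)
  next
    case False
    then obtain k' where k: "k = unit_exp j + k'" by (rule exponent_split)
    have "coeff_at (Var j * p) (unit_exp i + (unit_exp j + k')) = coeff_at p (unit_exp i + k')"
      by (metis add.left_commute coeff_at_Var_times_shift)
    then show ?thesis
      by (simp add: k coeff_at_partial lookup_add lookup_single distrib_right)
  qed
qed

lemma partial_mult: "partial i (p * q) = partial i p * q + p * partial i (q :: ('n::finite, 'a::comm_ring_1) mpoly)"
  by (induction p rule: mpoly_induct)
     (simp_all add: partial_add partial_Var_times mult.assoc distrib_left distrib_right)

lemma coeff_at_Var_partial: "coeff_at (Var i * partial i p) k = of_nat (Poly_Mapping.lookup k i) * coeff_at p k"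
proof (cases "Poly_Mapping.lookup k i = 0")
  case False
  then obtain k' where "k = unit_exp i + k'" by (rule exponent_split)
  then show ?thesis by (simp add: coeff_at_partial lookup_add)
qed (simp add: coeff_at_Var_times_0)

lemma euler:
  assumes "hom_part t p = p"
  shows "(\<Sum>i\<in>UNIV. Var i * partial i p) = of_nat t * p"
proof (rule poly_mapping_eqI)
  fix k
  have "coeff_at p k = 0 \<or> mono_deg k = t"
    using assms coeff_at_hom_part by metis
  then show "coeff_at (\<Sum>i\<in>UNIV. Var i * partial i p) k = coeff_at (of_nat t * p) k"
    by (auto simp: lookup_sum coeff_at_Var_partial mono_deg_def
        simp flip: sum_distrib_right of_nat_sum Const_of_nat)
qed

definition dir_deriv :: "('n::finite \<Rightarrow> 'a) \<Rightarrow> ('n, 'a::comm_ring_1) mpoly \<Rightarrow> ('n, 'a) mpoly" where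
  "dir_deriv v p = (\<Sum>i\<in>UNIV. Const (v i) * partial i p)"

lemma dir_deriv_0 [simp]: "dir_deriv v 0 = 0"
  and dir_deriv_Const [simp]: "dir_deriv v (Const a) = 0"
  and dir_deriv_add: "dir_deriv v (p + q) = dir_deriv v p + dir_deriv v q"
  and dir_deriv_diff: "dir_deriv v (p - q) = dir_deriv v p - dir_deriv v q"
  by (simp_all add: dir_deriv_def partial_add partial_diff sum.distrib sum_subtractf algebra_simps)

lemma dir_deriv_mult: "dir_deriv v (p * q) = dir_deriv v p * q + p * dir_deriv v q"
  by (simp add: dir_deriv_def partial_mult sum.distrib sum_distrib_left sum_distrib_right algebra_simps)

lemma dir_deriv_Const_times: "dir_deriv v (Const a * p) = Const a * dir_deriv v p"
  by (simp add: dir_deriv_mult)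

lemma dir_deriv_Var: "dir_deriv v (Var i) = Const (v i)"
proof -
  have *: "partial j (Var i) = (if j = i then 1 else 0)" for j
    using partial_Var_times[of j i 1] by simp
  show ?thesis unfolding dir_deriv_def * by (simp add: if_distrib sum.delta cong: if_cong)
qed

lemma dir_deriv_unit: "dir_deriv (\<lambda>j. if j = i then 1 else 0) = partial i"
  by (rule ext) (simp add: dir_deriv_def if_distrib if_distribR sum.delta cong: if_cong)

section \<open>The ideal generated by powers of the variables\<close>

text \<open>
  The ideal generated by the \<open>d\<close>-th powers of the variables, in terms of coefficients: no monomial
  with all exponents below \<open>d\<close> occurs. Working modulo this set replaces the quotient ring.
\<close>

definition pow_ideal :: "nat \<Rightarrow> ('n::finite, 'a::comm_ring_1) mpoly set" where
  "pow_ideal d = {p. \<forall>m. (\<forall>i. Poly_Mapping.lookup m i < d) \<longrightarrow> coeff_at p m = 0}"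

lemma pow_ideal_0 [simp]: "0 \<in> pow_ideal d"
  and pow_ideal_add: "p \<in> pow_ideal d \<Longrightarrow> q \<in> pow_ideal d \<Longrightarrow> p + q \<in> pow_ideal d"
  and pow_ideal_diff: "p \<in> pow_ideal d \<Longrightarrow> q \<in> pow_ideal d \<Longrightarrow> p - q \<in> pow_ideal d"
  and pow_ideal_Const_times: "p \<in> pow_ideal d \<Longrightarrow> Const a * p \<in> pow_ideal d"
  and pow_ideal_hom_part: "p \<in> pow_ideal d \<Longrightarrow> hom_part t p \<in> pow_ideal d"
  by (simp_all add: pow_ideal_def lookup_add lookup_minus coeff_at_hom_part)

lemma pow_ideal_Var_times:
  assumes "p \<in> pow_ideal d"
  shows "Var i * p \<in> pow_ideal d"
proof -
  have "coeff_at (Var i * p) m = 0" if m: "\<forall>j. Poly_Mapping.lookup m j < d" for m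
  proof (cases "Poly_Mapping.lookup m i = 0")
    case False
    then obtain k where k: "m = unit_exp i + k" by (rule exponent_split)
    have "Poly_Mapping.lookup k j < d" for j
      using m[rule_format, of j] by (simp add: k lookup_add)
    then show ?thesis using assms by (simp add: k pow_ideal_def)
  qed (simp add: coeff_at_Var_times_0)
  then show ?thesis by (simp add: pow_ideal_def)
qed

lemma pow_ideal_mult: "p \<in> pow_ideal d \<Longrightarrow> r * p \<in> pow_ideal d"
  by (induction r rule: mpoly_induct)
     (simp_all add: pow_ideal_Const_times pow_ideal_Var_times pow_ideal_add distrib_right mult.assoc)

lemma pow_ideal_sum: "(\<And>i. i \<in> A \<Longrightarrow> f i \<in> pow_ideal d) \<Longrightarrow> (\<Sum>i\<in>A. f i) \<in> pow_ideal d"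
  by (induction A rule: infinite_finite_induct) (simp_all add: pow_ideal_add)

lemma pow_ideal_cancel_of_int:
  fixes p :: "('n::finite, 'a::field_char_0) mpoly"
  assumes "of_int z * p \<in> pow_ideal d" "z \<noteq> 0"
  shows "p \<in> pow_ideal d"
  using assms by (simp add: pow_ideal_def flip: Const_of_int)

lemma Var_power: "Var i ^ n = Poly_Mapping.single (Poly_Mapping.single i n) 1"
  by (induction n) (simp_all add: Var_def mult_single flip: single_add)

lemma pow_ideal_subspace: "module.subspace (*) (pow_ideal d)"
  by (simp add: module.subspace_def[OF module_self] pow_ideal_add pow_ideal_mult)

lemma ideal_gen_powers:
  "ideal_gen {Var i ^ d | i. True} = (pow_ideal d :: ('n::finite, 'a::comm_ring_1) mpoly set)"
proof (intro equalityI subsetI)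
  fix p :: "('n, 'a) mpoly"
  {
    assume "p \<in> ideal_gen {Var i ^ d | i. True}"
    have "Var i ^ d \<in> (pow_ideal d :: ('n, 'a) mpoly set)" for i
    proof -
      have "coeff_at (Var i ^ d) m = 0" if "\<forall>j. Poly_Mapping.lookup m j < d" for m
      proof -
        have "Poly_Mapping.single i d \<noteq> m"
          using that[rule_format, of i] by auto
        then show ?thesis unfolding Var_power by (rule lookup_single_not_eq)
      qed
      then show ?thesis unfolding pow_ideal_def by blast
    qed
    then have "{Var i ^ d | i. True} \<subseteq> (pow_ideal d :: ('n, 'a) mpoly set)" by blast
    from module.span_minimal[OF module_self this pow_ideal_subspace] \<open>p \<in> ideal_gen _\<close>
    show "p \<in> pow_ideal d"
      unfolding ideal_gen_def by (rule subsetD)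
  next
    assume p: "p \<in> pow_ideal d"
    have "Poly_Mapping.single m (coeff_at p m) \<in> ideal_gen {Var i ^ d | i. True}"
      if "m \<in> Poly_Mapping.keys p" for m
    proof -
      have "\<not> (\<forall>i. Poly_Mapping.lookup m i < d)"
        using p that by (auto simp: pow_ideal_def in_keys_iff)
      then obtain i where i: "d \<le> Poly_Mapping.lookup m i"
        by (auto simp: not_less)
      have "(m - Poly_Mapping.single i d) + Poly_Mapping.single i d = m"
        using i by (intro poly_mapping_eqI) (auto simp: lookup_add lookup_minus lookup_single when_def)
      then have eq: "Poly_Mapping.single m (coeff_at p m) =
          Poly_Mapping.single (m - Poly_Mapping.single i d) (coeff_at p m) * Var i ^ d"
        by (simp add: Var_power mult_single)
      have "Var i ^ d \<in> {Var i ^ d | i. True}" by blast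
      then show ?thesis
        unfolding eq ideal_gen_def
        by (intro module.span_scale[OF module_self] module.span_base[OF module_self])
    qed
    then have "(\<Sum>m\<in>Poly_Mapping.keys p. Poly_Mapping.single m (coeff_at p m)) \<in> ideal_gen {Var i ^ d | i. True}"
      unfolding ideal_gen_def by (rule module.span_sum[OF module_self])
    then show "p \<in> ideal_gen {Var i ^ d | i. True}"
      by (simp only: sum_of_monomials[of p, symmetric])
  }
qed

lemma mem_ideal_gen_insert:
  "f \<in> ideal_gen (insert g {Var i ^ d | i. True}) \<longleftrightarrow> (\<exists>k. f - k * g \<in> pow_ideal d)"
  unfolding ideal_gen_def module.span_insert[OF module_self] ideal_gen_powers[unfolded ideal_gen_def]
  by simp

text \<open>
  By the pigeonhole principle a monomial of degree above \<open>n (d - 1)\<close> has an exponent \<open>\<ge> d\<close>.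
\<close>

lemma high_degree_in_pow_ideal:
  fixes p :: "('n::finite, 'a::comm_ring_1) mpoly"
  assumes "hom_part t p = p" "CARD('n) * (d - 1) < t"
  shows "p \<in> pow_ideal d"
proof -
  have "coeff_at p m = 0" if m: "\<forall>i. Poly_Mapping.lookup m i < d" for m
  proof -
    have "mono_deg m \<le> (\<Sum>i\<in>(UNIV::'n set). d - 1)"
      unfolding mono_deg_def by (intro sum_mono) (metis m One_nat_def Suc_leI Suc_pred diff_le_mono diff_Suc_1)
    then have "mono_deg m \<noteq> t" using assms(2) by simp
    then show ?thesis using assms(1) coeff_at_hom_part by metis
  qed
  then show ?thesis by (simp add: pow_ideal_def)
qed

section \<open>The strong Lefschetz property\<close>

text \<open>
  On powers of one variable this is \<open>x\<^sup>j \<mapsto> j (d - j) x\<^sup>j\<^sup>-\<^sup>1\<close>, the lowering operator of the irreducible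
  \<open>sl\<^sub>2\<close>-representation of dimension \<open>d\<close>, written as a differential operator on all polynomials. The
  factor \<open>d - j\<close> vanishes at \<open>j = d\<close>, so the operator descends to the quotient by \<open>x\<^sup>d\<close>.
\<close>

definition lowering_var :: "nat \<Rightarrow> 'n \<Rightarrow> ('n::finite, 'a::comm_ring_1) mpoly \<Rightarrow> ('n, 'a) mpoly" where
  "lowering_var d i p = Const (of_nat d - 1) * partial i p - Var i * partial i (partial i p)"

text \<open>
  The lowering operator that matches the raising operator \<open>linear_form c\<close>: the weights \<open>1 / c\<^sub>i\<close> cancel
  the coefficients of the form in the commutator, which removes the need to rescale the variables.
\<close>

definition lowering :: "nat \<Rightarrow> ('n \<Rightarrow> 'a) \<Rightarrow> ('n::finite, 'a::field) mpoly \<Rightarrow> ('n, 'a) mpoly" where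
  "lowering d c p = (\<Sum>i\<in>UNIV. Const (1 / c i) * lowering_var d i p)"

lemma coeff_at_lowering_var: "coeff_at (lowering_var d i p) k =
    of_nat (Suc (Poly_Mapping.lookup k i)) * (of_nat d - 1 - of_nat (Poly_Mapping.lookup k i))
      * coeff_at p (unit_exp i + k)"
  by (simp add: lowering_var_def lookup_minus coeff_at_Var_partial) (simp add: coeff_at_partial algebra_simps)

lemma lowering_var_pow_ideal:
  assumes "p \<in> pow_ideal d"
  shows "lowering_var d i p \<in> pow_ideal d"
proof -
  have "coeff_at (lowering_var d i p) k = 0" if k: "\<forall>j. Poly_Mapping.lookup k j < d" for k
  proof (cases "Poly_Mapping.lookup k i = d - 1")
    case True
    moreover have "d \<ge> 1" using k by (metis One_nat_def Suc_leI gr_zeroI not_less_zero)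
    ultimately show ?thesis by (simp add: coeff_at_lowering_var of_nat_diff)
  next
    case False
    have "Poly_Mapping.lookup (unit_exp i + k) j < d" for j
      using k[rule_format, of j] False by (auto simp: lookup_add lookup_single when_def)
    then show ?thesis using assms by (simp add: coeff_at_lowering_var pow_ideal_def)
  qed
  then show ?thesis by (simp add: pow_ideal_def)
qed

lemma lowering_pow_ideal: "p \<in> pow_ideal d \<Longrightarrow> lowering d c p \<in> pow_ideal d"
  unfolding lowering_def by (intro pow_ideal_sum pow_ideal_Const_times lowering_var_pow_ideal)

lemma lowering_add: "lowering d c (p + q) = lowering d c p + lowering d c q"
  and lowering_Const_times: "lowering d c (Const a * p) = Const a * lowering d c p"
  by (simp_all add: lowering_def lowering_var_def partial_add sum_distrib_left distrib_left right_diff_distrib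
      mult.left_commute flip: sum.distrib)
     (simp add: algebra_simps)

lemma lowering_of_int_times: "lowering d c (of_int z * p) = of_int z * lowering d c p"
  using lowering_Const_times[of d c "of_int z"] by (simp add: Const_of_int)

lemma hom_part_lowering: "hom_part t (lowering d c p) = lowering d c (hom_part (Suc t) p)"
proof -
  have "hom_part t (lowering_var d i p) = lowering_var d i (hom_part (Suc t) p)" for i
    by (intro poly_mapping_eqI) (simp add: coeff_at_hom_part coeff_at_lowering_var mono_deg_add)
  then show ?thesis by (simp add: lowering_def hom_part_sum hom_part_Const_times)
qed

lemma lowering_hom_part_0: "lowering d c (hom_part 0 p) = 0"
proof -
  have "lowering_var d i (hom_part 0 p) = 0" for i
    by (intro poly_mapping_eqI) (simp add: coeff_at_hom_part coeff_at_lowering_var mono_deg_add)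
  then show ?thesis by (simp add: lowering_def)
qed

lemma lowering_var_Var_times: "lowering_var d i (Var j * p) =
    Var j * lowering_var d i p + (if i = j then Const (of_nat d - 1) * p - 2 * (Var i * partial i p) else 0)"
  by (simp add: lowering_var_def partial_Var_times partial_add) (simp add: algebra_simps)

lemma lowering_var_sum: "lowering_var d i (\<Sum>j\<in>A. f j) = (\<Sum>j\<in>A. lowering_var d i (f j))"
  by (simp add: lowering_var_def partial_sum sum_distrib_left sum_subtractf)

lemma lowering_var_Const_times: "lowering_var d i (Const a * p) = Const a * lowering_var d i p"
  by (simp add: lowering_var_def right_diff_distrib mult.left_commute)

text \<open>
  The \<open>sl\<^sub>2\<close> commutator relation. Terms with different indices commute; those with equal indices
  contribute \<open>(d - 1) - 2 x\<^sub>i \<partial>\<^sub>i\<close>, and these add up to \<open>n (d - 1) - 2 t\<close> by Euler's formula.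
\<close>

lemma lowering_linear_form:
  fixes c :: "'n::finite \<Rightarrow> 'a::field"
  assumes c: "\<And>i. c i \<noteq> 0" and p: "hom_part t p = p" and d: "d \<ge> 1"
  shows "lowering d c (linear_form c * p) =
    linear_form c * lowering d c p + of_int (int (CARD('n) * (d - 1)) - 2 * int t) * p"
proof -
  define A where "A i j = Const (1 / c i) * (Const (c j) * (Var j * lowering_var d i p))" for i j
  define B where "B i = Const (of_nat d - 1) * p - 2 * (Var i * partial i p)" for i
  have lin: "lowering_var d i (linear_form c * p) = (\<Sum>j\<in>UNIV. Const (c j) * lowering_var d i (Var j * p))" for i
    by (simp only: linear_form_times lowering_var_sum lowering_var_Const_times)
  have inv: "Const (1 / c i) * (Const (c i) * q) = q" for i q
    using c[of i] by (simp add: mult.assoc[symmetric] flip: Const_mult)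
  have "Const (1 / c i) * lowering_var d i (linear_form c * p) = (\<Sum>j\<in>UNIV. A i j) + B i" for i
  proof -
    have "Const (1 / c i) * lowering_var d i (linear_form c * p)
        = (\<Sum>j\<in>UNIV. A i j + (if i = j then B i else 0))"
      unfolding lin sum_distrib_left A_def
      by (intro sum.cong refl) (auto simp: lowering_var_Var_times B_def inv distrib_left)
    then show ?thesis by (simp add: sum.distrib)
  qed
  then have "lowering d c (linear_form c * p) = (\<Sum>i\<in>UNIV. \<Sum>j\<in>UNIV. A i j) + (\<Sum>i\<in>UNIV. B i)"
    by (simp add: lowering_def sum.distrib)
  also have "(\<Sum>i\<in>UNIV. \<Sum>j\<in>UNIV. A i j) = linear_form c * lowering d c p"
    by (simp add: A_def lowering_def linear_form_times sum_distrib_left mult.left_commute)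
  also have "(\<Sum>i\<in>UNIV. B i) = of_int (int (CARD('n) * (d - 1)) - 2 * int t) * p"
  proof -
    have "(\<Sum>i\<in>UNIV. B i) = of_nat CARD('n) * Const (of_nat d - 1) * p - 2 * (of_nat t * p)"
      by (simp add: B_def sum_subtractf sum_constant mult.assoc flip: sum_distrib_left euler[OF p])
    then show ?thesis
      using d by (simp add: Const_diff Const_of_nat of_nat_diff algebra_simps)
  qed
  finally show ?thesis .
qed

context
  fixes c :: "'n::finite \<Rightarrow> 'a::field_char_0" and d s :: nat
  assumes c: "\<And>i. c i \<noteq> 0" and d: "d \<ge> 1" and s: "s = CARD('n) * (d - 1)"
begin

lemma lowering_linear_form_power:
  assumes p: "hom_part t p = p"
  shows "lowering d c (linear_form c ^ Suc n * p) =
    linear_form c ^ Suc n * lowering d c p + of_int ((int n + 1) * (int s - 2 * int t - int n)) * (linear_form c ^ n * p)"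
proof (induction n)
  case 0
  then show ?case using lowering_linear_form[OF c p d] by (simp add: s)
next
  case (Suc n)
  have hom: "hom_part (t + Suc n) (linear_form c ^ Suc n * p) = linear_form c ^ Suc n * p"
    unfolding hom_part_power_times p ..
  have "lowering d c (linear_form c * (linear_form c ^ Suc n * p)) =
      linear_form c * lowering d c (linear_form c ^ Suc n * p)
      + of_int (int s - 2 * int (t + Suc n)) * (linear_form c ^ Suc n * p)"
    using lowering_linear_form[OF c hom d] unfolding s .
  also have "linear_form c * lowering d c (linear_form c ^ Suc n * p)
      = linear_form c ^ Suc (Suc n) * lowering d c p
        + of_int ((int n + 1) * (int s - 2 * int t - int n)) * (linear_form c ^ Suc n * p)"
    unfolding Suc by (simp add: distrib_left mult.assoc mult.left_commute)
  also have "\<dots> + of_int (int s - 2 * int (t + Suc n)) * (linear_form c ^ Suc n * p)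
      = linear_form c ^ Suc (Suc n) * lowering d c p
        + of_int ((int n + 1) * (int s - 2 * int t - int n) + (int s - 2 * int (t + Suc n)))
          * (linear_form c ^ Suc n * p)"
    by (simp only: of_int_add distrib_right add.assoc)
  also have "(int n + 1) * (int s - 2 * int t - int n) + (int s - 2 * int (t + Suc n))
      = (int (Suc n) + 1) * (int s - 2 * int t - int (Suc n))"
    by (simp add: algebra_simps)
  finally show ?case by (simp only: power_Suc mult.assoc)
qed

text \<open>
  If \<open>\<ell>\<^sup>k p\<close> vanishes in the quotient, then so does \<open>\<ell>\<^sup>k\<^sup>+\<^sup>1 F p\<close>, where \<open>F\<close> is the lowering operator, and
  induction on the degree gives \<open>F p = 0\<close>. Then \<open>F \<ell>\<^sup>j\<^sup>+\<^sup>1 p\<close> is a multiple of \<open>\<ell>\<^sup>j p\<close>, with a factor that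
  is positive for \<open>j < k \<le> s - 2 t\<close>, so the exponent \<open>k\<close> can be brought down to \<open>0\<close>.
\<close>

theorem strong_lefschetz_injective:
  assumes "hom_part t p = p" "linear_form c ^ k * p \<in> pow_ideal d" "2 * t + k \<le> s"
  shows "p \<in> pow_ideal d"
  using assms
proof (induction t arbitrary: p k)
  have last: "p \<in> pow_ideal d"
    if p: "hom_part t p = p" and lowp: "lowering d c p \<in> pow_ideal d"
      and k: "linear_form c ^ k * p \<in> pow_ideal d" "2 * t + k \<le> s" for p t k
    using k
  proof (induction k)
    case (Suc k)
    let ?z = "(int k + 1) * (int s - 2 * int t - int k)"
    have "of_int ?z * (linear_form c ^ k * p)
        = lowering d c (linear_form c ^ Suc k * p) - linear_form c ^ Suc k * lowering d c p"
      unfolding lowering_linear_form_power[OF p] by simp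
    also have "\<dots> \<in> pow_ideal d"
      by (rule pow_ideal_diff[OF lowering_pow_ideal[OF Suc.prems(1)] pow_ideal_mult[OF lowp]])
    finally have "linear_form c ^ k * p \<in> pow_ideal d"
      by (rule pow_ideal_cancel_of_int) (use Suc.prems(2) in simp)
    then show ?case using Suc by simp
  qed simp
  {
    case 0
    have "lowering d c p = 0" using lowering_hom_part_0[of d c p] 0(1) by simp
    then show ?case using last[OF 0(1)] 0 by simp
  next
    case (Suc t)
    have "linear_form c ^ Suc k * lowering d c p
      = lowering d c (linear_form c ^ Suc k * p)
        - of_int ((int k + 1) * (int s - 2 * int (Suc t) - int k)) * (linear_form c ^ k * p)"
      unfolding lowering_linear_form_power[OF Suc.prems(1)] by simp
    also have "\<dots> \<in> pow_ideal d"
    proof -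
      have "linear_form c ^ Suc k * p \<in> pow_ideal d"
        using Suc.prems(2) by (simp add: pow_ideal_mult mult.assoc)
      then show ?thesis
        by (rule pow_ideal_diff[OF lowering_pow_ideal pow_ideal_mult[OF Suc.prems(2)]])
    qed
    finally have "linear_form c ^ Suc k * lowering d c p \<in> pow_ideal d" .
    moreover have "hom_part t (lowering d c p) = lowering d c p"
      using Suc.prems(1) by (simp add: hom_part_lowering)
    ultimately have "lowering d c p \<in> pow_ideal d"
      using Suc.IH[of "lowering d c p" "Suc k"] Suc.prems(3) by simp
    then show ?case using last[OF Suc.prems(1)] Suc.prems by blast
  }
qed

lemma lowering_power_linear_form:
  assumes p: "hom_part r p = p" and "k \<le> r"
  shows "(lowering d c ^^ Suc k) (linear_form c * p) =
    linear_form c * (lowering d c ^^ Suc k) p + of_int ((int k + 1) * (int s - 2 * int r + int k)) * (lowering d c ^^ k) p"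
  using assms(2)
proof (induction k)
  case 0
  then show ?case using lowering_linear_form[OF c p d] by (simp add: s)
next
  case (Suc k)
  have hom: "j \<le> r \<Longrightarrow> hom_part (r - j) ((lowering d c ^^ j) p) = (lowering d c ^^ j) p" for j
    by (induction j) (simp_all add: p hom_part_lowering Suc_diff_Suc)
  have "(lowering d c ^^ Suc (Suc k)) (linear_form c * p) =
      lowering d c (linear_form c * (lowering d c ^^ Suc k) p)
      + of_int ((int k + 1) * (int s - 2 * int r + int k)) * (lowering d c ^^ Suc k) p"
    using Suc by (simp add: lowering_add lowering_of_int_times del: of_int_mult of_int_add of_int_diff)
  also have "lowering d c (linear_form c * (lowering d c ^^ Suc k) p) =
      linear_form c * lowering d c ((lowering d c ^^ Suc k) p)
      + of_int (int s - 2 * int (r - Suc k)) * (lowering d c ^^ Suc k) p"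
    using lowering_linear_form[OF c hom[OF Suc.prems] d] unfolding s .
  finally show ?case using Suc.prems
    by (simp add: of_nat_diff algebra_simps)
qed

text \<open>
  Modulo multiples of \<open>\<ell>\<close>, the commutator relation turns \<open>F\<^sup>n\<^sup>+\<^sup>1 \<ell>\<^sup>n\<^sup>+\<^sup>1 p\<close> into a nonzero multiple of \<open>F\<^sup>n \<ell>\<^sup>n p\<close>.
  For large \<open>n\<close> the power \<open>\<ell>\<^sup>n p\<close> is zero for degree reasons; descending to \<open>n = 0\<close> shows that \<open>p\<close> is a
  multiple of \<open>\<ell>\<close> in the quotient.
\<close>

theorem lefschetz_surjective:
  assumes p: "hom_part u p = p" and u: "s < 2 * u"
  shows "\<exists>q. p - linear_form c * q \<in> pow_ideal d"
proof -
  have funpow_in: "q \<in> pow_ideal d \<Longrightarrow> (lowering d c ^^ n) q \<in> pow_ideal d" for n q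
    by (induction n) (simp_all add: lowering_pow_ideal)
  have "\<exists>q. (lowering d c ^^ 0) (linear_form c ^ 0 * p) - linear_form c * q \<in> pow_ideal d"
  proof (rule inc_induct[of 0 "Suc s"])
    have "linear_form c ^ Suc s * p \<in> pow_ideal d"
      by (rule high_degree_in_pow_ideal[of "u + Suc s"]) (simp_all only: hom_part_power_times p, simp add: s)
    then have "(lowering d c ^^ Suc s) (linear_form c ^ Suc s * p) - linear_form c * 0 \<in> pow_ideal d"
      using funpow_in[of _ "Suc s"] by (simp only: mult_zero_right diff_zero)
    then show "\<exists>q. (lowering d c ^^ Suc s) (linear_form c ^ Suc s * p) - linear_form c * q \<in> pow_ideal d"
      by blast
  next
    fix n
    assume "\<exists>q. (lowering d c ^^ Suc n) (linear_form c ^ Suc n * p) - linear_form c * q \<in> pow_ideal d"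
    then obtain q where
      q: "(lowering d c ^^ Suc n) (linear_form c ^ Suc n * p) - linear_form c * q \<in> pow_ideal d" ..
    define y where "y = linear_form c ^ n * p"
    define z where "z = (int n + 1) * (int s - 2 * int (u + n) + int n)"
    have y: "hom_part (u + n) y = y" by (simp add: y_def hom_part_power_times p)
    have z: "z \<noteq> 0" using u by (simp add: z_def)
    have "linear_form c ^ Suc n * p = linear_form c * y" by (simp add: y_def mult.assoc)
    with lowering_power_linear_form[OF y, of n]
    have *: "(lowering d c ^^ Suc n) (linear_form c ^ Suc n * p) =
       linear_form c * (lowering d c ^^ Suc n) y + of_int z * (lowering d c ^^ n) y"
      by (simp add: z_def)
    let ?q = "Const (1 / of_int z) * (q - (lowering d c ^^ Suc n) y)"
    have inv: "Const (1 / of_int z) * (of_int z * r) = r" for r :: "('n, 'a) mpoly"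
      using z by (simp add: mult.assoc[symmetric] flip: Const_mult Const_of_int)
    have "Const (1 / of_int z) * ((lowering d c ^^ Suc n) (linear_form c ^ Suc n * p) - linear_form c * q)
        = (lowering d c ^^ n) y - linear_form c * ?q"
      unfolding * by (simp add: inv distrib_left right_diff_distrib mult.left_commute[of "Const _" "linear_form _"] del: funpow.simps)
    then have "(lowering d c ^^ n) y - linear_form c * ?q \<in> pow_ideal d"
      using pow_ideal_Const_times[OF q] by metis
    then show "\<exists>q. (lowering d c ^^ n) (linear_form c ^ n * p) - linear_form c * q \<in> pow_ideal d"
      unfolding y_def by blast
  qed simp
  then show ?thesis by simp
qed

end

section \<open>The apolarity pairing\<close>

text \<open>
  Macaulay's inverse system: \<open>pairing p F\<close> is the constant term of the polynomial obtained by letting \<open>p\<close>,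
  with variables read as partial derivatives, act on \<open>F\<close>. Multiplication on the left is adjoint to
  differentiation on the right, so a suitable \<open>F\<close> certifies that a polynomial lies outside an ideal.
\<close>

definition pairing :: "('n::finite, 'a::comm_ring_1) mpoly \<Rightarrow> ('n, 'a) mpoly \<Rightarrow> 'a" where
  "pairing p F = (\<Sum>m\<in>Poly_Mapping.keys p.
     coeff_at p m * (\<Prod>i\<in>UNIV. of_nat (fact (Poly_Mapping.lookup m i))) * coeff_at F m)"

lemma pairing_superset:
  assumes "finite A" "Poly_Mapping.keys p \<subseteq> A"
  shows "pairing p F =
    (\<Sum>m\<in>A. coeff_at p m * (\<Prod>i\<in>UNIV. of_nat (fact (Poly_Mapping.lookup m i))) * coeff_at F m)"
  unfolding pairing_def
  by (rule sum.mono_neutral_left) (use assms in \<open>auto simp: in_keys_iff\<close>)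

lemma pairing_0 [simp]: "pairing 0 F = 0" "pairing p 0 = 0"
  by (simp_all add: pairing_def)

lemma pairing_1: "pairing 1 F = coeff_at F 0"
  by (simp add: pairing_def lookup_one)

lemma pairing_add: "pairing (p + q) F = pairing p F + pairing q F"
proof -
  let ?A = "Poly_Mapping.keys p \<union> Poly_Mapping.keys q"
  have "Poly_Mapping.keys (p + q) \<subseteq> ?A" by (rule keys_add)
  then show ?thesis
    by (simp add: pairing_superset[of ?A] lookup_add algebra_simps sum.distrib)
qed

lemma pairing_diff: "pairing (p - q) F = pairing p F - pairing q F"
  using pairing_add[of "p - q" q F] by simp

lemma pairing_Const_times: "pairing (Const a * p) F = a * pairing p F"
proof -
  have "Poly_Mapping.keys (Const a * p) \<subseteq> Poly_Mapping.keys p"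
    by (auto simp: in_keys_iff)
  then show ?thesis
    by (simp add: pairing_superset[of "Poly_Mapping.keys p"] sum_distrib_left mult.assoc)
qed

lemma pairing_add_right: "pairing p (F + G) = pairing p F + pairing p G"
  by (simp add: pairing_def lookup_add algebra_simps sum.distrib)

lemma pairing_Const_times_right: "pairing p (Const a * F) = a * pairing p F"
  by (simp add: pairing_def sum_distrib_left mult.left_commute)

lemma pairing_sum: "pairing (\<Sum>i\<in>A. f i) F = (\<Sum>i\<in>A. pairing (f i) F)"
  by (induction A rule: infinite_finite_induct) (simp_all add: pairing_add)

lemma pairing_sum_right: "pairing p (\<Sum>i\<in>A. f i) = (\<Sum>i\<in>A. pairing p (f i))"
  by (induction A rule: infinite_finite_induct) (simp_all add: pairing_add_right)

lemma pairing_Var_times: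
  "pairing (Var i * p) F = pairing p (partial i F :: ('n::finite, 'a::comm_ring_1) mpoly)"
proof -
  have "(\<Prod>j\<in>UNIV. of_nat (fact (Poly_Mapping.lookup (unit_exp i + m) j))) =
      of_nat (Suc (Poly_Mapping.lookup m i)) * (\<Prod>j\<in>UNIV. of_nat (fact (Poly_Mapping.lookup m j)) :: 'a)" for m
  proof -
    have "(\<Prod>j\<in>UNIV. of_nat (fact (Poly_Mapping.lookup (unit_exp i + m) j)) :: 'a) =
       (\<Prod>j\<in>UNIV. (if j = i then of_nat (Suc (Poly_Mapping.lookup m i)) else 1)
          * of_nat (fact (Poly_Mapping.lookup m j)))"
      by (intro prod.cong refl) (simp add: lookup_add lookup_single when_def algebra_simps)
    then show ?thesis by (simp add: prod.distrib prod.delta del: of_nat_Suc)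
  qed
  then show ?thesis
    by (simp add: pairing_def keys_Var_times sum.reindex coeff_at_partial mult.assoc mult.left_commute del: of_nat_Suc)
qed

lemma pairing_linear_form_times: "pairing (linear_form c * p) F = pairing p (dir_deriv c F)"
  by (simp add: linear_form_times dir_deriv_def pairing_sum pairing_sum_right pairing_Const_times
      pairing_Const_times_right pairing_Var_times)

lemma pairing_power_times: "pairing (linear_form c ^ n * p) F = pairing p ((dir_deriv c ^^ n) F)"
  by (induction n arbitrary: F) (simp_all add: pairing_linear_form_times mult.assoc funpow_swap1)

lemma pairing_Var_power_times: "pairing (Var i ^ n * p) F = pairing p ((partial i ^^ n) F)"
  by (induction n arbitrary: F) (simp_all add: pairing_Var_times mult.assoc funpow_swap1)

lemma pairing_pow_ideal:
  fixes F :: "('n::finite, 'a::comm_ring_1) mpoly"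
  assumes F: "\<And>i. (partial i ^^ d) F = 0" and p: "p \<in> pow_ideal d"
  shows "pairing p F = 0"
proof -
  define W where "W = {p. \<forall>r. pairing (r * p) F = 0}"
  have sub: "module.subspace (*) W"
    unfolding module.subspace_def[OF module_self] W_def
    by (simp add: distrib_left pairing_add flip: mult.assoc)
  have "pairing (r * Var i ^ d) F = 0" for r i
    using pairing_Var_power_times[of i d r F] F by (simp add: mult.commute)
  then have "{Var i ^ d | i. True} \<subseteq> W" by (auto simp: W_def)
  from module.span_minimal[OF module_self this sub]
  have "p \<in> W" using p unfolding ideal_gen_powers[symmetric] ideal_gen_def by (rule subsetD)
  then have "pairing (1 * p) F = 0" unfolding W_def by blast
  then show ?thesis by simp
qed

section \<open>Degree along a direction\<close>

text \<open>
  For \<open>v\<close> a unit vector this is the degree in one variable. For \<open>v = b\<close> and \<open>F\<close> homogeneous of degree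
  \<open>q\<close>, it means that \<open>F\<close> vanishes to order \<open>\<ge> q - k\<close> at the point \<open>b\<close>.
\<close>

definition deg_le :: "('n::finite \<Rightarrow> 'a::comm_ring_1) \<Rightarrow> nat \<Rightarrow> ('n, 'a) mpoly \<Rightarrow> bool" where
  "deg_le v k F \<longleftrightarrow> (dir_deriv v ^^ Suc k) F = 0"

lemma dir_deriv_funpow_0 [simp]: "(dir_deriv v ^^ k) 0 = 0"
  by (induction k) simp_all

lemma dir_deriv_funpow_add: "(dir_deriv v ^^ k) (F + G) = (dir_deriv v ^^ k) F + (dir_deriv v ^^ k) G"
  by (induction k) (simp_all add: dir_deriv_add)

lemma dir_deriv_funpow_Const_times: "(dir_deriv v ^^ k) (Const a * F) = Const a * (dir_deriv v ^^ k) F"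
  by (induction k) (simp_all add: dir_deriv_Const_times)

lemma deg_le_mono: "deg_le v k F \<Longrightarrow> k \<le> l \<Longrightarrow> deg_le v l F"
proof -
  assume "deg_le v k F" "k \<le> l"
  from this(2,1) show ?thesis by (induction l rule: dec_induct) (simp_all add: deg_le_def)
qed

lemma deg_le_Const: "deg_le v 0 (Const a)"
  by (simp add: deg_le_def)

lemma deg_le_mult:
  assumes "deg_le v k F" "deg_le v l G"
  shows "deg_le v (k + l) (F * G)"
proof -
  have "(dir_deriv v ^^ (k + l - 1)) (F * G) = 0" if "(dir_deriv v ^^ k) F = 0" "(dir_deriv v ^^ l) G = 0" for k l F G
    using that
  proof (induction "k + l" arbitrary: k l F G rule: less_induct)
    case less
    show ?case
    proof (cases "k = 0 \<or> l = 0")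
      case True
      then show ?thesis using less.prems by auto
    next
      case False
      then obtain k' l' where k: "k = Suc k'" and l: "l = Suc l'" by (metis not0_implies_Suc)
      have "(dir_deriv v ^^ (k' + l - 1)) (dir_deriv v F * G) = 0"
        using less.prems by (intro less.hyps) (simp_all add: k funpow_swap1)
      moreover have "(dir_deriv v ^^ (k + l' - 1)) (F * dir_deriv v G) = 0"
        using less.prems by (intro less.hyps) (simp_all add: l funpow_swap1)
      ultimately have "(dir_deriv v ^^ (k' + l')) (dir_deriv v (F * G)) = 0"
        by (simp add: dir_deriv_mult dir_deriv_funpow_add k l)
      then show ?thesis by (simp add: k l funpow_swap1)
    qed
  qed
  from this[of "Suc k" F "Suc l" G] assms show ?thesis by (simp add: deg_le_def)
qed

lemma deg_le_power:
  assumes "deg_le v k F"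
  shows "deg_le v (k * n) (F ^ n)"
proof (induction n)
  case 0
  then show ?case using deg_le_Const[of v 1] by simp
next
  case (Suc n)
  then show ?case using deg_le_mult[OF assms] by simp
qed

text \<open>
  For \<open>F\<close> homogeneous of degree \<open>k\<close> this says \<open>F(v) = a\<close>: the \<open>k\<close>-th derivative along \<open>v\<close> is
  \<open>k! F(v)\<close>. In this form values multiply like the forms themselves.
\<close>

definition top_value :: "('n::finite \<Rightarrow> 'a::comm_ring_1) \<Rightarrow> nat \<Rightarrow> ('n, 'a) mpoly \<Rightarrow> 'a \<Rightarrow> bool" where
  "top_value v k F a \<longleftrightarrow> (dir_deriv v ^^ k) F = Const (of_nat (fact k) * a)"

lemma top_value_mult:
  assumes "top_value v k F a" "top_value v l G b"
  shows "top_value v (k + l) (F * G) (a * b)"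
proof -
  have "(dir_deriv v ^^ (k + l)) (F * G) = Const (of_nat (k + l choose k) * (A * B))"
    if "(dir_deriv v ^^ k) F = Const A" "(dir_deriv v ^^ l) G = Const B" for k l F G A B
    using that
  proof (induction "k + l" arbitrary: k l F G rule: less_induct)
    case less
    consider "k = 0" | "l = 0" | k' l' where "k = Suc k'" "l = Suc l'"
      by (metis not0_implies_Suc)
    then show ?case
    proof cases
      case 1
      then show ?thesis using less.prems by (simp add: dir_deriv_funpow_Const_times Const_mult)
    next
      case 2
      then show ?thesis using less.prems
        by (simp add: dir_deriv_funpow_Const_times Const_mult mult.commute[of F])
    next
      case 3
      have "(dir_deriv v ^^ (k' + l)) (dir_deriv v F * G) = Const (of_nat (k' + l choose k') * (A * B))"
        using less.prems by (intro less.hyps) (simp_all add: 3 funpow_swap1)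
      moreover have "(dir_deriv v ^^ (k + l')) (F * dir_deriv v G) = Const (of_nat (k + l' choose k) * (A * B))"
        using less.prems by (intro less.hyps) (simp_all add: 3 funpow_swap1)
      ultimately have "(dir_deriv v ^^ (k' + l)) (dir_deriv v (F * G))
          = Const (of_nat ((k' + l choose k') + (k' + l choose k)) * (A * B))"
        by (simp add: dir_deriv_mult dir_deriv_add dir_deriv_funpow_add 3 distrib_right flip: Const_add)
      then show ?thesis by (simp add: 3 funpow_swap1)
    qed
  qed
  from this[of k F "of_nat (fact k) * a" l G "of_nat (fact l) * b"] assms
  have "(dir_deriv v ^^ (k + l)) (F * G)
      = Const (of_nat (fact k * fact l * (k + l choose k)) * (a * b))"
    by (simp add: top_value_def algebra_simps)
  also have "fact k * fact l * (k + l choose k) = fact (k + l)"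
    using binomial_fact_lemma[of k "k + l"] by simp
  finally show ?thesis by (simp add: top_value_def)
qed

lemma top_value_1: "top_value v 0 1 1"
  by (simp add: top_value_def)

lemma top_value_power: "top_value v k F a \<Longrightarrow> top_value v (k * n) (F ^ n) (a ^ n)"
  by (induction n) (simp_all add: top_value_1 top_value_mult)

lemma top_value_linear: "dir_deriv v F = Const a \<Longrightarrow> top_value v 1 F a"
  by (simp add: top_value_def)

lemma pairing_top_value:
  assumes "top_value v k F a"
  shows "pairing (linear_form v ^ k) F = of_nat (fact k) * a"
  using pairing_power_times[of v k 1 F] assms
  by (simp add: top_value_def pairing_1 coeff_at_Const)

section \<open>Translation-invariant forms\<close>

text \<open>
  In these coordinates the derivative along \<open>c\<close> is the infinitesimal translation of all coordinates,
  so that differences of coordinates are annihilated by it.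
\<close>

definition dual_coord :: "('n::finite \<Rightarrow> 'a::field) \<Rightarrow> 'n \<Rightarrow> ('n, 'a) mpoly" where
  "dual_coord c i = Const (1 / c i) * Var i"

lemma dir_deriv_dual_coord [simp]: "dir_deriv v (dual_coord c i) = Const (v i / c i)"
  by (simp add: dual_coord_def dir_deriv_Const_times dir_deriv_Var flip: Const_mult)

definition bracket :: "('n::finite \<Rightarrow> 'a::field) \<Rightarrow> 'n \<times> 'n \<Rightarrow> ('n, 'a) mpoly" where
  "bracket c e = dual_coord c (fst e) - dual_coord c (snd e)"

definition bracket_at :: "('n::finite \<Rightarrow> 'a::field) \<Rightarrow> ('n \<Rightarrow> 'a) \<Rightarrow> 'n \<times> 'n \<Rightarrow> 'a" where
  "bracket_at c v e = v (fst e) / c (fst e) - v (snd e) / c (snd e)"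

lemma dir_deriv_bracket: "dir_deriv v (bracket c e) = Const (bracket_at c v e)"
  by (simp add: bracket_def bracket_at_def dir_deriv_diff Const_diff)

definition graph_form :: "('n::finite \<Rightarrow> 'a::field) \<Rightarrow> ('n \<times> 'n) list \<Rightarrow> ('n, 'a) mpoly" where
  "graph_form c es = prod_list (map (bracket c) es)"

definition incidence :: "'n \<Rightarrow> ('n \<times> 'n) list \<Rightarrow> nat" where
  "incidence i es = length (filter (\<lambda>e. fst e = i \<or> snd e = i) es)"

lemma deg_le_bracket:
  "deg_le (\<lambda>j. if j = i then 1 else 0) (if fst e = i \<or> snd e = i then 1 else 0) (bracket c e)"
  by (auto simp: deg_le_def dir_deriv_bracket bracket_at_def)

lemma deg_le_graph_form:
  "deg_le (\<lambda>j. if j = i then 1 else 0) (incidence i es) (graph_form c es)"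
proof (induction es)
  case Nil
  then show ?case using deg_le_Const[of _ 1] by (simp add: graph_form_def incidence_def)
next
  case (Cons e es)
  from deg_le_mult[OF deg_le_bracket this, of e c] show ?case
    by (auto simp: graph_form_def incidence_def split: if_splits)
qed

lemma partial_funpow_eq_0:
  assumes "deg_le (\<lambda>j. if j = i then 1 else 0) k F" "k < d"
  shows "(partial i ^^ d) F = 0"
  using deg_le_mono[OF assms(1), of "d - 1"] assms(2) by (simp add: deg_le_def dir_deriv_unit)

lemma dir_deriv_prod_list_0:
  assumes "\<And>F. F \<in> set Fs \<Longrightarrow> dir_deriv v F = 0"
  shows "dir_deriv v (prod_list Fs) = 0"
  using assms
proof (induction Fs)
  case Nil
  then show ?case using dir_deriv_Const[of v 1] by simp
qed (simp add: dir_deriv_mult)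

lemma dir_deriv_graph_form_0:
  assumes "\<And>i. c i \<noteq> 0"
  shows "dir_deriv c (graph_form c es) = 0"
  unfolding graph_form_def
  by (rule dir_deriv_prod_list_0) (auto simp: dir_deriv_bracket bracket_at_def assms)

lemma top_value_graph_form:
  "top_value v (length es) (graph_form c es) (\<Prod>e\<leftarrow>es. bracket_at c v e)"
proof (induction es)
  case Nil
  then show ?case by (simp add: graph_form_def top_value_1)
next
  case (Cons e es)
  from top_value_mult[OF top_value_linear[OF dir_deriv_bracket] this]
  show ?case by (simp add: graph_form_def)
qed

text \<open>
  A product of differences over the edges of a multigraph is translation invariant, and its degree in
  a variable is at most the number of edges at that vertex. With fewer than \<open>d\<close> edges at each vertex it is
  therefore orthogonal to the linear form and to all \<open>d\<close>-th powers of variables.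
\<close>

lemma pairing_graph_form_eq_0:
  assumes c: "\<And>i. c i \<noteq> 0" and inc: "\<And>i. incidence i es < d"
    and p: "p - linear_form c * q \<in> pow_ideal d"
  shows "pairing p (graph_form c es) = 0"
proof -
  have "pairing (p - linear_form c * q) (graph_form c es) = 0"
    by (rule pairing_pow_ideal[OF _ p]) (rule partial_funpow_eq_0[OF deg_le_graph_form inc])
  then show ?thesis
    by (simp add: pairing_diff pairing_linear_form_times dir_deriv_graph_form_0[OF c])
qed

lemma dir_deriv_funpow_linear_times:
  assumes "dir_deriv v l = Const a"
  shows "(dir_deriv v ^^ Suc n) (l * G) = l * (dir_deriv v ^^ Suc n) G + of_nat (Suc n) * (Const a * (dir_deriv v ^^ n) G)"
proof (induction n)
  case 0
  then show ?case using assms by (simp add: dir_deriv_mult)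
next
  case (Suc n)
  have "dir_deriv v (of_nat (Suc n) * H) = of_nat (Suc n) * dir_deriv v H" for H
    using dir_deriv_Const_times[of v "of_nat (Suc n)" H] by (simp only: Const_of_nat)
  then have "(dir_deriv v ^^ Suc (Suc n)) (l * G) = l * (dir_deriv v ^^ Suc (Suc n)) G + Const a * (dir_deriv v ^^ Suc n) G
      + of_nat (Suc n) * (Const a * (dir_deriv v ^^ Suc n) G)"
    using Suc by (simp add: dir_deriv_add dir_deriv_mult dir_deriv_Const_times assms del: of_nat_Suc)
  then show ?case by (simp add: distrib_right)
qed

text \<open>
  The derivative along \<open>u\<close> at the point \<open>b\<close> of a product of linear forms, as a logarithmic derivative.
\<close>

lemma mixed_derivative_graph_form:
  fixes b c u :: "'n::finite \<Rightarrow> 'a::field"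
  assumes nz: "\<And>e. e \<in> set es \<Longrightarrow> bracket_at c b e \<noteq> 0" and ne: "es \<noteq> []"
  shows "dir_deriv u ((dir_deriv b ^^ (length es - 1)) (graph_form c es)) =
    Const (of_nat (fact (length es - 1)) * (\<Prod>e\<leftarrow>es. bracket_at c b e)
      * (\<Sum>e\<leftarrow>es. bracket_at c u e / bracket_at c b e))"
  using nz ne
proof (induction es)
  case (Cons e es)
  let ?G = "graph_form c es" and ?n = "length es"
  let ?P = "\<Prod>e\<leftarrow>es. bracket_at c b e" and ?S = "\<Sum>e\<leftarrow>es. bracket_at c u e / bracket_at c b e"
  have e: "bracket_at c b e \<noteq> 0" using Cons.prems by simp
  have G: "graph_form c (e # es) = bracket c e * ?G" by (simp add: graph_form_def)
  show ?case
  proof (cases ?n)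
    case 0
    then show ?thesis using e by (simp add: graph_form_def dir_deriv_bracket)
  next
    case (Suc n)
    have top: "(dir_deriv b ^^ Suc n) ?G = Const (of_nat (fact (Suc n)) * ?P)"
      using top_value_graph_form[of b es c] by (simp add: top_value_def Suc)
    have IH: "dir_deriv u ((dir_deriv b ^^ n) ?G) = Const (of_nat (fact n) * ?P * ?S)"
      using Cons.IH Cons.prems Suc by (cases es) auto
    have N: "dir_deriv u (of_nat (Suc n)) = 0"
      using dir_deriv_Const[of u "of_nat (Suc n)"] by (simp only: Const_of_nat)
    have "dir_deriv u ((dir_deriv b ^^ Suc n) (graph_form c (e # es))) =
        Const (bracket_at c u e) * Const (of_nat (fact (Suc n)) * ?P)
        + of_nat (Suc n) * (Const (bracket_at c b e) * Const (of_nat (fact n) * ?P * ?S))"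
      unfolding G dir_deriv_funpow_linear_times[OF dir_deriv_bracket] top
      by (simp only: dir_deriv_add dir_deriv_mult dir_deriv_Const N IH dir_deriv_bracket dir_deriv_Const_times mult_zero_right mult_zero_left add_0_right add_0_left)
    also have "\<dots> = Const (of_nat (fact (Suc n)) * (bracket_at c b e * ?P) * (bracket_at c u e / bracket_at c b e + ?S))"
    proof -
      have "bracket_at c u e * (of_nat (fact (Suc n)) * ?P)
          + of_nat (Suc n) * (bracket_at c b e * (of_nat (fact n) * ?P * ?S))
        = of_nat (fact (Suc n)) * (bracket_at c b e * ?P) * (bracket_at c u e / bracket_at c b e + ?S)"
        using e by (simp add: field_simps)
      then show ?thesis by (simp only: flip: Const_of_nat Const_mult Const_add)
    qed
    finally show ?thesis by (simp add: Suc)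
  qed
qed simp

section \<open>Powers that survive modulo the powers of the variables and a linear form\<close>

text \<open>
  Nonzero coefficients give both linear forms the strong Lefschetz property; the last condition says
  that the ratios \<open>b\<^sub>i / c\<^sub>i\<close> are distinct points of the line.
\<close>

definition generic_pair :: "('n::finite \<Rightarrow> 'a::field) \<Rightarrow> ('n \<Rightarrow> 'a) \<Rightarrow> bool" where
  "generic_pair b c \<longleftrightarrow> (\<forall>i. b i \<noteq> 0) \<and> (\<forall>i. c i \<noteq> 0) \<and> (\<forall>i j. i \<noteq> j \<longrightarrow> b i * c j \<noteq> b j * c i)"

lemma generic_pair_bracket:
  assumes "generic_pair b c" "fst e \<noteq> snd e"
  shows "bracket_at c b e \<noteq> 0"
  using assms by (auto simp: generic_pair_def bracket_at_def field_simps)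

lemma UNIV_5: "(UNIV :: 5 set) = {0, 1, 2, 3, 4}"
  by (rule sym, rule card_subset_eq) simp_all

lemma all_5: "(\<forall>i::5. P i) \<longleftrightarrow> P 0 \<and> P 1 \<and> P 2 \<and> P 3 \<and> P 4"
  using UNIV_5 by (metis UNIV_I insertE singletonD)

definition pentagon :: "(5 \<times> 5) list" where
  "pentagon = [(0, 1), (1, 2), (2, 3), (3, 4), (4, 0)]"

lemma incidence_append: "incidence i (es @ fs) = incidence i es + incidence i fs"
  by (simp add: incidence_def)

lemma incidence_pentagon: "incidence i pentagon = 2"
proof -
  have "\<forall>i. incidence i pentagon = 2"
    unfolding all_5 by (simp add: incidence_def pentagon_def)
  then show ?thesis ..
qed

lemma incidence_pentagons: "incidence i (concat (replicate h pentagon)) = 2 * h"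
  by (induction h) (simp_all add: incidence_append incidence_pentagon, simp add: incidence_def)

lemma length_pentagons: "length (concat (replicate h pentagon)) = 5 * h"
  by (induction h) (simp_all add: pentagon_def)

lemma pentagon_edges: "e \<in> set pentagon \<Longrightarrow> fst e \<noteq> snd e"
  by (auto simp: pentagon_def)

lemma set_pentagons: "e \<in> set (concat (replicate h pentagon)) \<Longrightarrow> fst e \<noteq> snd e"
  using pentagon_edges by (cases h) auto

text \<open>
  In \<open>h\<close> copies of the pentagon each vertex lies on \<open>2 h = d - 1\<close> edges, and the corresponding product
  of differences does not vanish at distinct points.
\<close>

lemma power_not_in_ideal_odd:
  fixes b c :: "5 \<Rightarrow> 'a::field_char_0"
  assumes g: "generic_pair b c" and d: "d = 2 * h + 1"
  shows "linear_form b ^ (5 * h) - linear_form c * q \<notin> pow_ideal d"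
proof
  assume q: "linear_form b ^ (5 * h) - linear_form c * q \<in> pow_ideal d"
  let ?es = "concat (replicate h pentagon)"
  have c: "\<And>i. c i \<noteq> 0" using g by (simp add: generic_pair_def)
  have "pairing (linear_form b ^ (5 * h)) (graph_form c ?es) = 0"
    by (rule pairing_graph_form_eq_0[OF c _ q]) (simp add: incidence_pentagons d)
  moreover have "pairing (linear_form b ^ (5 * h)) (graph_form c ?es) =
      of_nat (fact (5 * h)) * (\<Prod>e\<leftarrow>?es. bracket_at c b e)"
    by (rule pairing_top_value) (use top_value_graph_form[of b ?es c] in \<open>simp add: length_pentagons\<close>)
  moreover have "(\<Prod>e\<leftarrow>?es. bracket_at c b e) \<noteq> 0"
    using generic_pair_bracket[OF g set_pentagons, of _ h] by (auto simp: prod_list_zero_iff)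
  ultimately show False by simp
qed

text \<open>
  The graph consisting of \<open>h\<close> pentagons and two further disjoint edges \<open>e\<close>, \<open>f\<close> has \<open>5 h + 2\<close> edges and
  at most \<open>d - 1\<close> at each vertex. The membership makes the sum over its edges of the ratios \<open>r\<close>
  (difference of \<open>v\<close> over difference of \<open>b\<close>) vanish. If \<open>e\<close> and \<open>f\<close> run through the disjoint pairs of edges of
  the pentagon itself, they form a cycle of odd length \<open>5\<close>, which forces all five ratios to be zero. So
  \<open>v\<close> is constant in the coordinates \<open>v\<^sub>i / c\<^sub>i\<close>.
\<close>

lemma linear_times_power_in_ideal_even:
  fixes b c v :: "5 \<Rightarrow> 'a::field_char_0"
  assumes g: "generic_pair b c" and d: "d = 2 * h + 2"
    and q: "linear_form v * linear_form b ^ (5 * h + 1) - linear_form c * q \<in> pow_ideal d"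
  shows "\<exists>t. \<forall>i. v i = t * c i"
proof -
  define r where "r e = bracket_at c v e / bracket_at c b e" for e
  define R where "R = (\<Sum>e\<leftarrow>pentagon. r e)"
  have c: "\<And>i. c i \<noteq> 0" using g by (simp add: generic_pair_def)
  have rel: "of_nat h * R + r e + r f = 0"
    if e: "e \<in> set pentagon" "f \<in> set pentagon" and ef: "\<And>i. incidence i [e, f] \<le> 1" for e f
  proof -
    let ?es = "concat (replicate h pentagon) @ [e, f]"
    have nz: "bracket_at c b e' \<noteq> 0" if "e' \<in> set ?es" for e'
    proof (rule generic_pair_bracket[OF g])
      have "e' \<in> set pentagon" using that e by (auto split: if_splits)
      then show "fst e' \<noteq> snd e'" by (rule pentagon_edges)
    qed
    have "incidence i ?es < d" for i
      using ef[of i] by (simp add: incidence_append incidence_pentagons d)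
    from pairing_graph_form_eq_0[OF c this q]
    have "pairing (linear_form v * linear_form b ^ (5 * h + 1)) (graph_form c ?es) = 0" .
    moreover have "pairing (linear_form v * linear_form b ^ (5 * h + 1)) (graph_form c ?es) =
        coeff_at (dir_deriv v ((dir_deriv b ^^ (5 * h + 1)) (graph_form c ?es))) 0"
      using pairing_power_times[of b "5 * h + 1" "linear_form v * 1"]
        pairing_linear_form_times[of v 1] by (simp only: pairing_1 mult_1_left mult_1_right mult.commute)
    moreover have "dir_deriv v ((dir_deriv b ^^ (5 * h + 1)) (graph_form c ?es)) =
        Const (of_nat (fact (5 * h + 1)) * (\<Prod>e\<leftarrow>?es. bracket_at c b e) * (\<Sum>e\<leftarrow>?es. r e))"
      using mixed_derivative_graph_form[where es = ?es and b = b and c = c and u = v, OF nz]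
      by (simp add: length_pentagons r_def)
    moreover have "(\<Prod>e\<leftarrow>?es. bracket_at c b e) \<noteq> 0"
      using nz by (auto simp: prod_list_zero_iff)
    moreover have "of_nat (fact (5 * h + 1)) \<noteq> (0::'a)"
      using fact_nonzero of_nat_eq_0_iff by blast
    ultimately have "(\<Sum>e\<leftarrow>?es. r e) = 0"
      by (simp only: coeff_at_Const mult_eq_0_iff simp_thms if_True)
    moreover have "(\<Sum>e\<leftarrow>concat (replicate h pentagon). r e) = of_nat h * R"
      by (induction h) (simp_all add: R_def algebra_simps)
    ultimately show ?thesis by (simp add: add.assoc)
  qed
  define r0 r1 r2 r3 r4 where "r0 = r (0, 1)" and "r1 = r (1, 2)" and "r2 = r (2, 3)"
    and "r3 = r (3, 4)" and "r4 = r (4, 0)"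
  have inc: "\<forall>i. incidence i [(0::5, 1), (2, 3)] \<le> 1" "\<forall>i. incidence i [(2::5, 3), (4, 0)] \<le> 1"
    "\<forall>i. incidence i [(4::5, 0), (1, 2)] \<le> 1" "\<forall>i. incidence i [(1::5, 2), (3, 4)] \<le> 1"
    "\<forall>i. incidence i [(3::5, 4), (0, 1)] \<le> 1"
    unfolding all_5 by (simp_all add: incidence_def)
  have eqs: "of_nat h * R + r0 + r2 = 0" "of_nat h * R + r2 + r4 = 0" "of_nat h * R + r4 + r1 = 0"
    "of_nat h * R + r1 + r3 = 0" "of_nat h * R + r3 + r0 = 0"
    unfolding r0_def r1_def r2_def r3_def r4_def
    by (rule rel; use inc in \<open>simp add: pentagon_def\<close>)+
  have R: "R = r0 + r1 + r2 + r3 + r4"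
    by (simp add: R_def pentagon_def r0_def r1_def r2_def r3_def r4_def add.assoc)
  \<comment> \<open>Each edge occurs in two of the five relations, so their sum determines the total \<open>R\<close>.\<close>
  have "of_nat (5 * h + 2) * R = (of_nat h * R + r0 + r2) + (of_nat h * R + r2 + r4)
      + (of_nat h * R + r4 + r1) + (of_nat h * R + r1 + r3) + (of_nat h * R + r3 + r0)"
    unfolding of_nat_add of_nat_mult by (simp add: R algebra_simps)
  then have "of_nat (5 * h + 2) * R = 0" unfolding eqs by simp
  moreover have "of_nat (5 * h + 2) \<noteq> (0::'a)" by (simp only: of_nat_eq_0_iff)
  ultimately have "R = 0" by simp
  then have "r0 = - r2" "r2 = - r4" "r4 = - r1" "r1 = - r3" "r3 = - r0"
    using eqs by (simp_all add: eq_neg_iff_add_eq_0)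
  \<comment> \<open>Going once around the odd cycle changes the sign of \<open>r0\<close>.\<close>
  then have "2 * r0 = 0" "r4 = r0" "r1 = - r0" "r2 = - r0" "r3 = - r0" by simp_all
  then have "r0 = 0" "r1 = 0" "r2 = 0" "r3 = 0" by simp_all
  moreover have "bracket_at c v e = 0" if "r e = 0" "fst e \<noteq> snd e" for e
    using that generic_pair_bracket[OF g that(2)] by (simp add: r_def)
  ultimately have "v 0 / c 0 = v 1 / c 1" "v 1 / c 1 = v 2 / c 2" "v 2 / c 2 = v 3 / c 3"
      "v 3 / c 3 = v 4 / c 4"
    unfolding r0_def r1_def r2_def r3_def by (force simp: bracket_at_def)+
  then have "\<forall>i. v i / c i = v 0 / c 0" unfolding all_5 by simp
  then have "v i = v 0 / c 0 * c i" for i using c[of i] by (metis nonzero_eq_divide_eq)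
  then show ?thesis by blast
qed

section \<open>Planes and conics through a point\<close>

lemma deg_le_Const_times: "deg_le v k F \<Longrightarrow> deg_le v k (Const a * F)"
  unfolding deg_le_def dir_deriv_funpow_Const_times by simp

lemma dir_deriv_funpow_diff: "(dir_deriv v ^^ k) (F - G) = (dir_deriv v ^^ k) F - (dir_deriv v ^^ k) G"
  by (induction k) (simp_all add: dir_deriv_diff)

lemma deg_le_diff: "deg_le v k F \<Longrightarrow> deg_le v k G \<Longrightarrow> deg_le v k (F - G)"
  unfolding deg_le_def dir_deriv_funpow_diff by simp

lemma top_value_Const_times: "top_value v k F x \<Longrightarrow> top_value v k (Const a * F) (a * x)"
  unfolding top_value_def dir_deriv_funpow_Const_times by (simp add: mult.left_commute flip: Const_mult)

lemma top_value_diff: "top_value v k F x \<Longrightarrow> top_value v k G y \<Longrightarrow> top_value v k (F - G) (x - y)"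
  unfolding top_value_def dir_deriv_funpow_diff by (simp add: right_diff_distrib flip: Const_diff)

lemma dir_deriv_power_0:
  assumes "dir_deriv v F = 0"
  shows "dir_deriv v (F ^ n) = 0"
  using deg_le_power[of v 0 F n] assms by (simp add: deg_le_def)

text \<open>
  The translation-invariant linear form in the coordinates \<open>i, j, k\<close> that vanishes at \<open>b\<close>.
\<close>

definition plane_form :: "('n::finite \<Rightarrow> 'a::field) \<Rightarrow> ('n \<Rightarrow> 'a) \<Rightarrow> 'n \<Rightarrow> 'n \<Rightarrow> 'n \<Rightarrow> ('n, 'a) mpoly" where
  "plane_form b c i j k = Const (bracket_at c b (i, j)) * bracket c (i, k)
     - Const (bracket_at c b (i, k)) * bracket c (i, j)"

text \<open>
  The equation that fixes the cross-ratio of the coordinates \<open>i, j, k, l\<close> to its value at \<open>b\<close>.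
\<close>

definition conic_form :: "('n::finite \<Rightarrow> 'a::field) \<Rightarrow> ('n \<Rightarrow> 'a) \<Rightarrow> 'n \<Rightarrow> 'n \<Rightarrow> 'n \<Rightarrow> 'n \<Rightarrow> ('n, 'a) mpoly" where
  "conic_form b c i j k l =
     Const (bracket_at c b (i, j) * bracket_at c b (k, l)) * graph_form c [(i, k), (j, l)]
   - Const (bracket_at c b (i, k) * bracket_at c b (j, l)) * graph_form c [(i, j), (k, l)]"

lemma dir_deriv_plane_form: "dir_deriv v (plane_form b c i j k) =
    Const (bracket_at c b (i, j) * bracket_at c v (i, k) - bracket_at c b (i, k) * bracket_at c v (i, j))"
  by (simp add: plane_form_def dir_deriv_diff dir_deriv_Const_times dir_deriv_bracket Const_diff Const_mult)

lemma dir_deriv_plane_form_base: "dir_deriv b (plane_form b c i j k) = 0"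
  by (simp add: dir_deriv_plane_form)

lemma bracket_at_self: "(\<And>i. c i \<noteq> 0) \<Longrightarrow> bracket_at c c e = 0"
  by (simp add: bracket_at_def)

lemma deg_le_plane_form:
  "deg_le (\<lambda>v. if v = u then 1 else 0) (if u \<in> {i, j, k} then 1 else 0) (plane_form b c i j k)"
  unfolding plane_form_def
  by (intro deg_le_diff deg_le_Const_times; rule deg_le_mono[OF deg_le_bracket]) auto

lemma dir_deriv_conic_form:
  assumes "\<And>i. c i \<noteq> 0"
  shows "dir_deriv c (conic_form b c i j k l) = 0"
  by (simp add: conic_form_def dir_deriv_diff dir_deriv_Const_times dir_deriv_graph_form_0[OF assms])

lemma top_value_conic_form: "top_value v 2 (conic_form b c i j k l)
  (bracket_at c b (i, j) * bracket_at c b (k, l) * (bracket_at c v (i, k) * bracket_at c v (j, l))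
   - bracket_at c b (i, k) * bracket_at c b (j, l) * (bracket_at c v (i, j) * bracket_at c v (k, l)))"
  unfolding conic_form_def
  using top_value_graph_form[of v "[(i, k), (j, l)]" c] top_value_graph_form[of v "[(i, j), (k, l)]" c]
  by (intro top_value_diff top_value_Const_times) (simp_all add: eval_nat_numeral)

lemma deg_le_conic_form_base: "deg_le b 1 (conic_form b c i j k l)"
  using top_value_conic_form[of b b c i j k l]
  by (simp add: top_value_def deg_le_def eval_nat_numeral algebra_simps)

lemma deg_le_conic_form:
  assumes "distinct [i, j, k, l]"
  shows "deg_le (\<lambda>v. if v = u then 1 else 0) (if u \<in> {i, j, k, l} then 1 else 0) (conic_form b c i j k l)"
  unfolding conic_form_def
  by (intro deg_le_diff deg_le_Const_times; rule deg_le_mono[OF deg_le_graph_form])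
     (use assms in \<open>auto simp: incidence_def\<close>)

text \<open>
  A form of degree \<open>2 D + j\<close> with degree at most \<open>D\<close> in each of the five variables that vanishes to order \<open>D\<close> at
  \<open>b\<close>. For \<open>j = 0\<close> it is a power of a plane times a power of the complementary edge. Replacing two
  planes and one edge by two conics, which miss the vertices \<open>4\<close> and \<open>3\<close>, keeps the degrees in the variables
  and the order of vanishing and raises the total degree by one.
\<close>

definition special_form :: "(5 \<Rightarrow> 'a::field) \<Rightarrow> (5 \<Rightarrow> 'a) \<Rightarrow> nat \<Rightarrow> nat \<Rightarrow> (5, 'a) mpoly" where
  "special_form b c D j = plane_form b c 0 1 2 ^ (D - 2 * j) * bracket c (3, 4) ^ (D - j)
     * (conic_form b c 0 1 2 3 ^ j * conic_form b c 0 1 2 4 ^ j)"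

lemma deg_le_special_form_base:
  assumes "2 * j \<le> D"
  shows "deg_le b (D + j) (special_form b c D j)"
proof -
  have "deg_le b 0 (plane_form b c 0 1 2)" by (simp add: deg_le_def dir_deriv_plane_form_base)
  moreover have "deg_le b 1 (bracket c (3, 4))" by (simp add: deg_le_def dir_deriv_bracket)
  ultimately have "deg_le b (0 * (D - 2 * j) + 1 * (D - j) + (1 * j + 1 * j)) (special_form b c D j)"
    unfolding special_form_def
    by (intro deg_le_mult deg_le_power deg_le_conic_form_base)
  moreover have "0 * (D - 2 * j) + 1 * (D - j) + (1 * j + 1 * j) = D + j" using assms by simp
  ultimately show ?thesis by metis
qed

lemma deg_le_special_form:
  assumes "2 * j \<le> D"
  shows "deg_le (\<lambda>v. if v = u then 1 else 0) D (special_form b c D j)"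
proof -
  let ?k = "(if u \<in> {0, 1, 2} then 1 else 0) * (D - 2 * j)
    + (if fst (3 :: 5, 4 :: 5) = u \<or> snd (3 :: 5, 4 :: 5) = u then 1 else 0) * (D - j)
    + ((if u \<in> {0, 1, 2, 3} then 1 else 0) * j + (if u \<in> {0, 1, 2, 4} then 1 else 0) * j)"
  have "deg_le (\<lambda>v. if v = u then 1 else 0) ?k (special_form b c D j)"
    unfolding special_form_def
    by (intro deg_le_mult deg_le_power deg_le_conic_form deg_le_plane_form deg_le_bracket) simp_all
  moreover have "\<forall>u :: 5. (if u \<in> {0, 1, 2} then 1 else 0) * (D - 2 * j)
    + (if fst (3 :: 5, 4 :: 5) = u \<or> snd (3 :: 5, 4 :: 5) = u then 1 else 0) * (D - j)
    + ((if u \<in> {0, 1, 2, 3} then 1 else 0) * j + (if u \<in> {0, 1, 2, 4} then 1 else 0) * j) = D"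
    unfolding all_5 using assms by simp
  ultimately show ?thesis by metis
qed

lemma dir_deriv_special_form:
  assumes "\<And>i. c i \<noteq> 0"
  shows "dir_deriv c (special_form b c D j) = 0"
  unfolding special_form_def
  by (simp add: dir_deriv_mult dir_deriv_power_0 dir_deriv_conic_form[OF assms] dir_deriv_plane_form dir_deriv_bracket
      bracket_at_self assms)

text \<open>
  At the point with coordinates \<open>(1, 0, 0, 1, 2)\<close> each factor has a nonzero value; for the conics this is
  the Pluecker relation between differences of the \<open>a\<^sub>i\<close>.
\<close>

lemma special_form_nonzero:
  fixes b c :: "5 \<Rightarrow> 'a::field_char_0"
  assumes g: "generic_pair b c" and j: "2 * j \<le> D"
  shows "\<exists>w x. top_value w (2 * D + j) (special_form b c D j) x \<and> x \<noteq> 0"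
proof -
  have c: "\<And>i. c i \<noteq> 0" using g by (simp add: generic_pair_def)
  define z :: "5 \<Rightarrow> 'a" where "z i = (if i = 0 \<or> i = 3 then 1 else if i = 4 then 2 else 0)" for i
  define w where "w i = z i * c i" for i
  define a where "a i = b i / c i" for i
  have bw: "bracket_at c w (i, j) = z i - z j" for i j
    using c by (simp add: bracket_at_def w_def)
  have bb: "bracket_at c b (i, j) = a i - a j" for i j
    by (simp add: bracket_at_def a_def)
  have a: "a i - a j \<noteq> 0" if "i \<noteq> j" for i j
    using generic_pair_bracket[OF g, of "(i, j)"] that by (simp add: bb)
  have P: "top_value w 1 (plane_form b c 0 1 2) (a 2 - a 1)"
    by (rule top_value_linear) (simp add: dir_deriv_plane_form bw bb z_def)
  have E: "top_value w 1 (bracket c (3, 4)) (- 1)"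
    by (rule top_value_linear) (simp add: dir_deriv_bracket bw z_def)
  have Q: "top_value w 2 (conic_form b c 0 1 2 k) (z k * ((a 0 - a k) * (a 1 - a 2)))" for k
    using top_value_conic_form[of w b c 0 1 2 k] by (simp add: bw bb z_def algebra_simps)
  let ?x = "(a 2 - a 1) ^ (D - 2 * j) * (- 1) ^ (D - j)
     * ((z 3 * ((a 0 - a 3) * (a 1 - a 2))) ^ j * (z 4 * ((a 0 - a 4) * (a 1 - a 2))) ^ j)"
  have "top_value w (1 * (D - 2 * j) + 1 * (D - j) + (2 * j + 2 * j)) (special_form b c D j) ?x"
    unfolding special_form_def by (intro top_value_mult top_value_power P E Q)
  moreover have "1 * (D - 2 * j) + 1 * (D - j) + (2 * j + 2 * j) = 2 * D + j" using j by simp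
  moreover have "?x \<noteq> 0"
    using a[of 2 1] a[of 1 2] a[of 0 3] a[of 0 4] by (simp add: z_def)
  ultimately show ?thesis by metis
qed

text \<open>
  The special form is orthogonal to the ideal generated by the \<open>d\<close>-th powers of the variables, \<open>\<ell>\<close> and \<open>L\<^sup>m\<close>,
  but not to the power of the linear form given by a point where it does not vanish.
\<close>

lemma cokernel_nonzero:
  fixes b c :: "5 \<Rightarrow> 'a::field_char_0"
  assumes g: "generic_pair b c" and j: "2 * j \<le> D" and m: "D + j < m"
  shows "\<exists>w. \<forall>f k. linear_form w ^ (2 * D + j) - linear_form c * f - linear_form b ^ m * k \<notin> pow_ideal (Suc D)"
proof -
  have c: "\<And>i. c i \<noteq> 0" using g by (simp add: generic_pair_def)
  obtain w x where w: "top_value w (2 * D + j) (special_form b c D j) x" "x \<noteq> 0"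
    using special_form_nonzero[OF g j] by blast
  have False if "linear_form w ^ (2 * D + j) - linear_form c * f - linear_form b ^ m * k \<in> pow_ideal (Suc D)" for f k
  proof -
    have "pairing (linear_form w ^ (2 * D + j) - linear_form c * f - linear_form b ^ m * k) (special_form b c D j) = 0"
      by (rule pairing_pow_ideal[OF _ that])
         (rule partial_funpow_eq_0[OF deg_le_special_form[OF j]], simp)
    moreover have "(dir_deriv b ^^ m) (special_form b c D j) = 0"
      using deg_le_mono[OF deg_le_special_form_base[OF j, of b c], of "m - 1"] m
      by (simp add: deg_le_def less_Suc_eq_le[symmetric])
    ultimately have "pairing (linear_form w ^ (2 * D + j)) (special_form b c D j) = 0"
      by (simp add: pairing_diff pairing_linear_form_times pairing_power_times dir_deriv_special_form[OF c])
    then show False using pairing_top_value[OF w(1)] w(2) by simp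
  qed
  then show ?thesis by blast
qed

section \<open>The relation coming from the twisted cubic\<close>

text \<open>
  Power series that become polynomials of degree at most \<open>k\<close> in the quotient by \<open>pow_ideal d\<close>. The
  bound is an integer because it can be negative, which means that the series vanishes in the quotient.
\<close>

definition fps_le :: "nat \<Rightarrow> int \<Rightarrow> ('n::finite, 'a::comm_ring_1) mpoly fps set" where
  "fps_le d k = {f. \<forall>n. k < int n \<longrightarrow> fps_nth f n \<in> pow_ideal d}"

lemma fps_le_0: "0 \<in> fps_le d k"
  and fps_le_add: "f \<in> fps_le d k \<Longrightarrow> g \<in> fps_le d k \<Longrightarrow> f + g \<in> fps_le d k"
  by (simp_all add: fps_le_def pow_ideal_add)

lemma fps_le_sum: "(\<And>i. i \<in> A \<Longrightarrow> f i \<in> fps_le d k) \<Longrightarrow> (\<Sum>i\<in>A. f i) \<in> fps_le d k"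
  by (induction A rule: infinite_finite_induct) (simp_all add: fps_le_0 fps_le_add)

lemma fps_le_mult:
  assumes f: "f \<in> fps_le d k" and g: "g \<in> fps_le d l"
  shows "f * g \<in> fps_le d (k + l)"
proof -
  have "fps_nth (f * g) n \<in> pow_ideal d" if n: "k + l < int n" for n
    unfolding fps_mult_nth
  proof (rule pow_ideal_sum)
    fix i assume "i \<in> {0..n}"
    then have "k < int i \<or> l < int (n - i)" using n by auto
    then show "fps_nth f i * fps_nth g (n - i) \<in> pow_ideal d"
    proof
      assume "k < int i"
      then have "fps_nth f i \<in> pow_ideal d" using f by (simp add: fps_le_def)
      then show ?thesis using pow_ideal_mult[of "fps_nth f i" d "fps_nth g (n - i)"] by (simp add: mult.commute)
    next
      assume "l < int (n - i)"
      then have "fps_nth g (n - i) \<in> pow_ideal d" using g by (simp add: fps_le_def)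
      then show ?thesis by (rule pow_ideal_mult)
    qed
  qed
  then show ?thesis by (simp add: fps_le_def)
qed

lemma fps_le_const: "fps_const a \<in> fps_le d 0"
  by (simp add: fps_le_def)

lemma fps_le_power: "f \<in> fps_le d k \<Longrightarrow> f ^ n \<in> fps_le d (int n * k)"
proof (induction n)
  case 0
  then show ?case using fps_le_const[of 1] by simp
next
  case (Suc n)
  then have "f * f ^ n \<in> fps_le d (k + int n * k)" by (intro fps_le_mult) simp_all
  then show ?case by (simp add: algebra_simps)
qed

text \<open>
  \<open>lin_fps a\<close> is \<open>1 - a \<sigma>\<close> for the series variable \<open>\<sigma>\<close>, and \<open>geo_fps a\<close> is its inverse.
\<close>

definition lin_fps :: "'a \<Rightarrow> ('n::finite, 'a::comm_ring_1) mpoly fps" where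
  "lin_fps a = 1 - fps_const (Const a) * fps_X"

definition geo_fps :: "'a \<Rightarrow> ('n::finite, 'a::comm_ring_1) mpoly fps" where
  "geo_fps a = Abs_fps (\<lambda>n. Const (a ^ n))"

lemma geo_fps_rec: "geo_fps a = 1 + fps_X * (fps_const (Const a) * geo_fps a)"
proof (rule fps_ext)
  fix n
  show "fps_nth (geo_fps a) n = fps_nth (1 + fps_X * (fps_const (Const a) * geo_fps a)) n"
    by (cases n) (simp_all add: geo_fps_def Const_mult)
qed

lemma lin_geo_fps: "lin_fps a * geo_fps a = 1"
proof -
  have "lin_fps a * geo_fps a = geo_fps a - fps_X * (fps_const (Const a) * geo_fps a)"
    by (simp add: lin_fps_def algebra_simps)
  then show ?thesis using geo_fps_rec[of a] by (metis add_diff_cancel_right')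
qed

lemma lin_fps_le: "lin_fps a \<in> fps_le d 1"
  by (simp add: fps_le_def lin_fps_def)

text \<open>
  The power \<open>x\<^sup>q / (1 - a \<sigma>)\<^sup>q\<close> either vanishes in the quotient or has a denominator that the
  factor \<open>(1 - a \<sigma>)\<^sup>d\<^sup>-\<^sup>1\<close> cancels.
\<close>

lemma lin_geo_power_fps_le:
  fixes a e :: "'a::comm_ring_1" and i :: "'n::finite"
  assumes "d \<ge> 1"
  shows "lin_fps a ^ (d - 1) * (fps_const (Const e * Var i) * geo_fps a) ^ q \<in> fps_le d (int d - 1 - int q)"
proof (cases "q < d")
  case True
  have "lin_fps a ^ (d - 1) = lin_fps a ^ (d - 1 - q) * (lin_fps a :: ('n, 'a) mpoly fps) ^ q"
    using True by (simp flip: power_add)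
  then have "lin_fps a ^ (d - 1) * (fps_const (Const e * Var i) * geo_fps a) ^ q
      = lin_fps a ^ (d - 1 - q) * fps_const (Const e * Var i) ^ q * (lin_fps a * geo_fps a) ^ q"
    by (simp add: power_mult_distrib mult.assoc mult.left_commute)
  also have "\<dots> = lin_fps a ^ (d - 1 - q) * fps_const (Const e * Var i) ^ q"
    by (simp add: lin_geo_fps)
  also have "\<dots> \<in> fps_le d (int (d - 1 - q) * 1 + int q * 0)"
    by (intro fps_le_mult fps_le_power lin_fps_le fps_le_const)
  also have "int (d - 1 - q) * 1 + int q * 0 = int d - 1 - int q" using True by simp
  finally show ?thesis .
next
  case False
  have "Var i ^ d \<in> pow_ideal d"
    unfolding ideal_gen_powers[symmetric] ideal_gen_def by (rule module.span_base[OF module_self]) blast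
  then have "Const e ^ q * Var i ^ (q - d) * Var i ^ d \<in> pow_ideal d" by (rule pow_ideal_mult)
  then have y: "(Const e * Var i) ^ q \<in> pow_ideal d"
    using False by (simp add: power_mult_distrib mult.assoc flip: power_add)
  have "fps_const ((Const e * Var i) ^ q) * H \<in> fps_le d k" for H k
    using pow_ideal_mult[OF y] by (simp add: fps_le_def mult.commute)
  from this[of "lin_fps a ^ (d - 1) * geo_fps a ^ q"] show ?thesis
    by (simp add: power_mult_distrib fps_const_power mult.left_commute)
qed

text \<open>
  Restricting forms with degree at most \<open>d - 1\<close> in each variable to the curve \<open>z\<^sub>i = 1 / (1 - a\<^sub>i \<sigma>)\<close> and
  clearing denominators gives polynomials of degree \<open>n (d - 1) - q\<close>. This is the dual statement: the
  \<open>q\<close>-th power of the linear form of a point on the curve is taken modulo the powers of the variables.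
\<close>

lemma prod_lin_sum_geo_fps_le:
  assumes d: "d \<ge> 1" and "finite T"
  shows "(\<Prod>i\<in>T. lin_fps (a i) ^ (d - 1)) * (\<Sum>i\<in>T. fps_const (Const (c i) * Var i) * geo_fps (a i)) ^ q
    \<in> fps_le d (int (card T) * (int d - 1) - int q)"
  using assms(2)
proof (induction T arbitrary: q rule: finite_induct)
  case empty
  show ?case
  proof (cases q)
    case 0
    then show ?thesis using fps_le_const[of 1 d] by simp
  qed (simp add: fps_le_0)
next
  case (insert x T)
  let ?A = "lin_fps (a x) ^ (d - 1)" and ?B = "\<Prod>i\<in>T. lin_fps (a i) ^ (d - 1)"
  let ?u = "fps_const (Const (c x) * Var x) * geo_fps (a x)"
  let ?v = "\<Sum>i\<in>T. fps_const (Const (c i) * Var i) * geo_fps (a i)"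
  have "?A * ?B * (?u + ?v) ^ q = (\<Sum>k\<le>q. of_nat (q choose k) * ((?A * ?u ^ k) * (?B * ?v ^ (q - k))))"
    unfolding binomial_ring sum_distrib_left by (intro sum.cong refl) (simp add: algebra_simps)
  also have "\<dots> \<in> fps_le d (int (card (insert x T)) * (int d - 1) - int q)"
  proof (rule fps_le_sum)
    fix k assume k: "k \<in> {..q}"
    have "of_nat (q choose k) * ((?A * ?u ^ k) * (?B * ?v ^ (q - k)))
      \<in> fps_le d (0 + ((int d - 1 - int k) + (int (card T) * (int d - 1) - int (q - k))))"
      by (intro fps_le_mult lin_geo_power_fps_le d insert.IH)
         (metis fps_of_nat fps_le_const)
    then show "of_nat (q choose k) * ((?A * ?u ^ k) * (?B * ?v ^ (q - k)))
      \<in> fps_le d (int (card (insert x T)) * (int d - 1) - int q)"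
      using k insert.hyps by (simp add: of_nat_diff algebra_simps)
  qed
  finally show ?case using insert.hyps by simp
qed

lemma power_sum_split:
  fixes x y :: "'b::comm_ring_1"
  shows "\<exists>h. (x + y) ^ n = y ^ n + x * h"
proof (induction n)
  case 0
  show ?case by (intro exI[of _ 0]) simp
next
  case (Suc n)
  then obtain h where "(x + y) ^ n = y ^ n + x * h" ..
  then have "(x + y) ^ Suc n = y ^ Suc n + x * ((x + y) * h + y ^ n)" by (simp add: algebra_simps)
  then show ?case by blast
qed

text \<open>
  A coefficient of low order picks few factors \<open>K \<sigma>\<close>, so it keeps at least \<open>m\<close> factors \<open>l\<close>, and
  exactly \<open>m\<close> only in the term that takes \<open>K \<sigma>\<close> the maximal number of times.
\<close>

lemma fps_nth_power_split:
  fixes G K :: "'b::comm_ring_1 fps"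
  assumes "N \<ge> 1"
  shows "\<exists>h. fps_nth (G * (fps_const l + fps_X * K) ^ (m + N)) N =
    l ^ m * (of_nat (m + N choose N) * (fps_nth G 0 * fps_nth K 0 ^ N) + l * h)"
proof -
  have nth: "fps_nth (fps_X ^ k * (H :: 'b fps)) N = (if k \<le> N then fps_nth H (N - k) else 0)" for k H
    by (simp add: fps_X_power_mult_nth)
  define t where "t k = of_nat (m + N choose k) * (l ^ (m + N - k) * fps_nth (G * K ^ k) (N - k))" for k
  have "G * (fps_const l + fps_X * K) ^ (m + N) =
      (\<Sum>k\<le>m + N. fps_X ^ k * (fps_const (of_nat (m + N choose k) * l ^ (m + N - k)) * (G * K ^ k)))"
  proof -
    have const: "fps_const (of_nat k * l ^ r) = of_nat k * fps_const l ^ r" for k r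
      by (simp only: fps_const_mult[symmetric] fps_of_nat fps_const_power)
    have "G * (fps_X * K + fps_const l) ^ (m + N) =
      (\<Sum>k\<le>m + N. fps_X ^ k * (fps_const (of_nat (m + N choose k) * l ^ (m + N - k)) * (G * K ^ k)))"
      unfolding binomial_ring sum_distrib_left const power_mult_distrib
      by (intro sum.cong refl) (simp only: ac_simps)
    then show ?thesis by (simp only: add.commute)
  qed
  then have "fps_nth (G * (fps_const l + fps_X * K) ^ (m + N)) N = (\<Sum>k\<le>m + N. if k \<le> N then t k else 0)"
    by (simp add: fps_sum_nth nth t_def mult.assoc cong: if_cong)
  also have "\<dots> = (\<Sum>k\<le>N. t k)"
    by (rule sum.mono_neutral_cong_right) auto
  also have "\<dots> = (\<Sum>k<N. t k) + t N"
    by (simp add: lessThan_Suc_atMost[symmetric])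
  also have "t N = l ^ m * (of_nat (m + N choose N) * (fps_nth G 0 * fps_nth K 0 ^ N))"
    by (simp add: t_def fps_nth_power_0)
  also have "(\<Sum>k<N. t k) = l ^ m * (l * (\<Sum>k<N. of_nat (m + N choose k) * (l ^ (N - k - 1) * fps_nth (G * K ^ k) (N - k))))"
    unfolding sum_distrib_left
  proof (intro sum.cong refl)
    fix k assume "k \<in> {..<N}"
    then have "m + N - k = m + (1 + (N - k - 1))" by simp
    then have "l ^ (m + N - k) = l ^ m * (l * l ^ (N - k - 1))" by (simp only: power_add power_one_right)
    then show "t k = l ^ m * (l * (of_nat (m + N choose k) * (l ^ (N - k - 1) * fps_nth (G * K ^ k) (N - k))))"
      by (simp add: t_def mult.left_commute mult.assoc)
  qed
  finally have "fps_nth (G * (fps_const l + fps_X * K) ^ (m + N)) N = l ^ m *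
      (of_nat (m + N choose N) * (fps_nth G 0 * fps_nth K 0 ^ N)
       + l * (\<Sum>k<N. of_nat (m + N choose k) * (l ^ (N - k - 1) * fps_nth (G * K ^ k) (N - k))))"
    by (simp only: distrib_left add.commute)
  then show ?thesis by blast
qed

text \<open>
  With \<open>a\<^sub>i = b\<^sub>i / c\<^sub>i\<close> and \<open>y\<^sub>i = c\<^sub>i x\<^sub>i\<close>, let \<open>K\<^sub>e = \<Sum>\<^sub>i a\<^sub>i\<^sup>e y\<^sub>i / (1 - a\<^sub>i \<sigma>)\<close>, whose constant term is \<open>\<ell>\<close>, \<open>L\<close> and
  \<open>M = \<Sum>\<^sub>i a\<^sub>i\<^sup>2 y\<^sub>i\<close> for \<open>e = 0, 1, 2\<close>, and \<open>K\<^sub>e = K\<^sub>e(0) + \<sigma> K\<^sub>e\<^sub>+\<^sub>1\<close>. The points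
  \<open>1 / (1 - a\<^sub>i \<sigma>)\<close> describe, up to translation and for five points, a twisted cubic. In the
  quotient \<open>\<Prod>(1 - a\<^sub>i \<sigma>)\<^sup>d\<^sup>-\<^sup>1 K\<^sub>0\<^sup>q\<close> is a polynomial of degree \<open>n (d - 1) - q\<close>, whereas modulo \<open>\<ell>\<close> it equals
  \<open>\<sigma>\<^sup>q \<Prod>(1 - a\<^sub>i \<sigma>)\<^sup>d\<^sup>-\<^sup>1 K\<^sub>1\<^sup>q\<close>. Hence the coefficient of \<open>\<sigma>\<^sup>N\<close> in the last product without \<open>\<sigma>\<^sup>q\<close> is zero modulo
  \<open>\<ell>\<close> as soon as \<open>q + N > n (d - 1) - q\<close>, and that coefficient is \<open>L\<^sup>m\<close> times an explicit form.
\<close>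

lemma twisted_cubic_relation:
  fixes b c :: "'n::finite \<Rightarrow> 'a::field_char_0"
  assumes c: "\<And>i. c i \<noteq> 0" and d: "d \<ge> 1" and N: "N \<ge> 1"
    and big: "CARD('n) * (d - 1) < (m + N) + (m + N) + N"
  shows "\<exists>f h. linear_form b ^ m * (of_nat (m + N choose N) * linear_form (\<lambda>i. b i * b i / c i) ^ N
      + linear_form b * h) - linear_form c * f \<in> pow_ideal d"
proof -
  define a where "a i = b i / c i" for i
  define y :: "'n \<Rightarrow> ('n, 'a) mpoly" where "y i = Const (c i) * Var i" for i
  define G :: "('n, 'a) mpoly fps" where "G = (\<Prod>i\<in>UNIV. lin_fps (a i) ^ (d - 1))"
  define K where "K e = (\<Sum>i\<in>UNIV. fps_const (Const (a i ^ e) * y i) * geo_fps (a i))" for e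
  define l where "l e = (\<Sum>i\<in>UNIV. Const (a i ^ e) * y i)" for e
  have K: "K e = fps_const (l e) + fps_X * K (Suc e)" for e
  proof -
    have "fps_const (Const (a i ^ e) * y i) * geo_fps (a i) =
      fps_const (Const (a i ^ e) * y i) + fps_X * (fps_const (Const (a i ^ Suc e) * y i) * geo_fps (a i))" for i
      by (subst geo_fps_rec) (simp add: algebra_simps Const_mult flip: fps_const_mult)
    then have "K e = (\<Sum>i\<in>UNIV. fps_const (Const (a i ^ e) * y i)) + fps_X * K (Suc e)"
      by (simp add: K_def sum.distrib sum_distrib_left)
    also have "(\<Sum>i\<in>UNIV. fps_const (Const (a i ^ e) * y i)) = fps_const (l e)"
      by (rule fps_ext) (simp add: l_def fps_sum_nth)
    finally show ?thesis .
  qed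
  have K_0: "fps_nth (K e) 0 = l e" for e using K[of e] by simp
  have G_0: "fps_nth G 0 = 1"
  proof -
    have "fps_nth (\<Prod>i\<in>T. lin_fps (a i) ^ (d - 1)) 0 = (1 :: ('n, 'a) mpoly)" for T :: "'n set"
      by (induction T rule: infinite_finite_induct) (simp_all add: lin_fps_def fps_nth_power_0)
    then show ?thesis by (simp add: G_def)
  qed
  have l0: "l 0 = linear_form c" by (simp add: l_def linear_form_def y_def)
  have l1: "l 1 = linear_form b" using c by (simp add: l_def linear_form_def y_def a_def mult.assoc[symmetric] flip: Const_mult)
  have l2: "l 2 = linear_form (\<lambda>i. b i * b i / c i)"
    using c by (simp add: l_def linear_form_def y_def a_def power2_eq_square mult.assoc[symmetric] flip: Const_mult)
  let ?q = "m + N"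
  obtain H where H: "K 0 ^ ?q = (fps_X * K 1) ^ ?q + fps_const (l 0) * H"
    using power_sum_split[of "fps_const (l 0)" "fps_X * K 1" ?q] K[of 0] by auto
  have "G * K 0 ^ ?q \<in> fps_le d (int CARD('n) * (int d - 1) - int ?q)"
    using prod_lin_sum_geo_fps_le[OF d, of UNIV a c ?q] by (simp add: G_def K_def y_def)
  moreover have "int CARD('n) * (int d - 1) - int ?q < int (?q + N)"
  proof -
    have "int (CARD('n) * (d - 1)) < int ((m + N) + (m + N) + N)" using big by (simp only: of_nat_less_iff)
    then show ?thesis using d by (simp add: of_nat_diff)
  qed
  ultimately have "fps_nth (G * K 0 ^ ?q) (?q + N) \<in> pow_ideal d" by (simp add: fps_le_def)
  moreover have "G * K 0 ^ ?q = fps_X ^ ?q * (G * K 1 ^ ?q) + fps_const (l 0) * (G * H)"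
    unfolding H by (simp add: power_mult_distrib algebra_simps)
  ultimately have *: "fps_nth (G * K 1 ^ ?q) N + l 0 * fps_nth (G * H) (?q + N) \<in> pow_ideal d"
    by (simp add: fps_X_power_mult_nth)
  obtain h where h: "fps_nth (G * K 1 ^ ?q) N
      = l 1 ^ m * (of_nat (?q choose N) * (fps_nth G 0 * fps_nth (K 2) 0 ^ N) + l 1 * h)"
    using fps_nth_power_split[OF N, of G "l 1" "K 2" m] K[of 1] by (auto simp: numeral_2_eq_2)
  show ?thesis
    using * unfolding h K_0 G_0 l0 l1 l2
    by (intro exI[of _ "- fps_nth (G * H) (?q + N)"] exI[of _ h]) simp
qed

section \<open>Maximal rank on the quotient\<close>

lemma homog_diff: "f \<in> homog t \<Longrightarrow> g \<in> homog t \<Longrightarrow> f - g \<in> homog t"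
  by (auto simp: homog_def in_keys_iff lookup_minus)

lemma homog_0: "0 \<in> homog t"
  by (simp add: homog_def)

lemma linear_form_times_homog:
  assumes "p \<in> homog t"
  shows "linear_form c * p \<in> homog (t + 1)"
proof (cases "t < 0")
  case True
  then show ?thesis using assms by (simp add: homog_neg homog_0)
next
  case False
  then obtain n where t: "t = int n" by (metis nonneg_int_cases not_less)
  with assms have "hom_part (Suc n) (linear_form c * p) = linear_form c * p"
    by (simp add: homog_iff_hom_part hom_part_linear_form_times)
  then have "linear_form c * p \<in> homog (int (Suc n))" by (simp only: homog_iff_hom_part)
  then show ?thesis by (simp add: t add.commute)
qed

lemma residue_class_eq_iff:
  assumes "module.subspace (*) I"
  shows "residue_class I f = residue_class I g \<longleftrightarrow> f - g \<in> I"
proof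
  assume "residue_class I f = residue_class I g"
  moreover have "f \<in> residue_class I f"
    using module.subspace_0[OF module_self assms] by (simp add: residue_class_def)
  ultimately show "f - g \<in> I" by (simp add: residue_class_def)
next
  assume fg: "f - g \<in> I"
  have "h - f \<in> I \<longleftrightarrow> h - g \<in> I" for h
    using module.subspace_add[OF module_self assms _ fg, of "h - f"]
      module.subspace_diff[OF module_self assms _ fg, of "h - g"] by auto
  then show "residue_class I f = residue_class I g" by (simp add: residue_class_def)
qed

lemma quot_mult_inj_iff:
  assumes I: "module.subspace (*) I"
  shows "inj_on (quot_mult I l) (quot_component I t) \<longleftrightarrow> (\<forall>f\<in>homog t. l * f \<in> I \<longrightarrow> f \<in> I)"
proof
  assume inj: "inj_on (quot_mult I l) (quot_component I t)"
  show "\<forall>f\<in>homog t. l * f \<in> I \<longrightarrow> f \<in> I"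
  proof (intro ballI impI)
    fix f assume f: "f \<in> homog t" "l * f \<in> I"
    then have "residue_class I (l * f) = residue_class I (l * 0)"
      using residue_class_eq_iff[OF I] by simp
    then have "quot_mult I l (residue_class I f) = quot_mult I l (residue_class I 0)"
      by (simp only: quot_mult_residue_class[OF I])
    then have "residue_class I f = residue_class I 0"
      using inj f(1) homog_0 by (auto simp: quot_component_def dest: inj_onD)
    then show "f \<in> I" using residue_class_eq_iff[OF I] by simp
  qed
next
  assume *: "\<forall>f\<in>homog t. l * f \<in> I \<longrightarrow> f \<in> I"
  show "inj_on (quot_mult I l) (quot_component I t)"
  proof (rule inj_onI, unfold quot_component_def, elim imageE)
    fix C D f g
    assume eq: "quot_mult I l C = quot_mult I l D"
      and C: "C = residue_class I f" "f \<in> homog t" and D: "D = residue_class I g" "g \<in> homog t"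
    have "l * (f - g) \<in> I"
      using eq by (simp add: C D quot_mult_residue_class[OF I] residue_class_eq_iff[OF I] right_diff_distrib)
    then have "f - g \<in> I" using * homog_diff[OF C(2) D(2)] by blast
    then show "C = D" by (simp add: C D residue_class_eq_iff[OF I])
  qed
qed

lemma quot_mult_surj_iff:
  assumes I: "module.subspace (*) I"
  shows "quot_mult I (linear_form c) ` quot_component I t = quot_component I (t + 1) \<longleftrightarrow>
    (\<forall>g\<in>homog (t + 1). \<exists>f\<in>homog t. g - linear_form c * f \<in> I)"
proof -
  have "quot_mult I (linear_form c) ` quot_component I t
      = (\<lambda>f. residue_class I (linear_form c * f)) ` homog t"
    by (simp add: quot_component_def image_image quot_mult_residue_class[OF I])
  also have "\<dots> \<subseteq> quot_component I (t + 1)"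
    using linear_form_times_homog by (auto simp: quot_component_def)
  finally have "quot_mult I (linear_form c) ` quot_component I t = quot_component I (t + 1) \<longleftrightarrow>
     quot_component I (t + 1) \<subseteq> (\<lambda>f. residue_class I (linear_form c * f)) ` homog t"
    by (simp add: quot_component_def image_image quot_mult_residue_class[OF I] set_eq_subset)
  also have "\<dots> \<longleftrightarrow> (\<forall>g\<in>homog (t + 1). \<exists>f\<in>homog t. residue_class I g = residue_class I (linear_form c * f))"
    by (auto simp: quot_component_def image_iff subset_iff)
  finally show ?thesis by (simp add: residue_class_eq_iff[OF I])
qed

text \<open>
  The condition that \<open>has_WLP\<close> imposes on one linear form.
\<close>

definition max_rank :: "('n::finite, 'a::field) mpoly set \<Rightarrow> ('n, 'a) mpoly \<Rightarrow> bool" where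
  "max_rank I l \<longleftrightarrow> (\<forall>t. inj_on (quot_mult I l) (quot_component I t) \<or>
     quot_mult I l ` quot_component I t = quot_component I (t + 1))"

definition form_ideal :: "nat \<Rightarrow> nat \<Rightarrow> ('n::finite \<Rightarrow> 'a) \<Rightarrow> ('n, 'a::field) mpoly set" where
  "form_ideal d m b = ideal_gen (insert (linear_form b ^ m) {Var i ^ d | i. True})"

lemma form_ideal_subspace: "module.subspace (*) (form_ideal d m b)"
  unfolding form_ideal_def ideal_gen_def by (rule module.subspace_span[OF module_self])

lemma mem_form_ideal: "f \<in> form_ideal d m b \<longleftrightarrow> (\<exists>k. f - linear_form b ^ m * k \<in> pow_ideal d)"
  unfolding form_ideal_def mem_ideal_gen_insert by (simp add: mult.commute)

lemma pow_ideal_in_form_ideal: "f \<in> pow_ideal d \<Longrightarrow> f \<in> form_ideal d m b"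
  unfolding mem_form_ideal by (intro exI[of _ 0]) simp

lemma mem_form_ideal_homog:
  assumes "f \<in> form_ideal d m b" "hom_part t f = f" "m \<le> t"
  shows "\<exists>k. hom_part (t - m) k = k \<and> f - linear_form b ^ m * k \<in> pow_ideal d"
proof -
  obtain k where "f - linear_form b ^ m * k \<in> pow_ideal d" using assms(1) mem_form_ideal by blast
  from pow_ideal_hom_part[OF this, of t] have "f - linear_form b ^ m * hom_part (t - m) k \<in> pow_ideal d"
    using hom_part_power_times[of "t - m" m b k] assms(2,3) by (simp add: hom_part_diff)
  then show ?thesis using hom_part_idem by blast
qed

lemma mem_form_ideal_below:
  assumes "f \<in> form_ideal d m b" "hom_part t f = f" "t < m"
  shows "f \<in> pow_ideal d"
proof -
  obtain k where "f - linear_form b ^ m * k \<in> pow_ideal d" using assms(1) mem_form_ideal by blast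
  from pow_ideal_hom_part[OF this, of t] show ?thesis
    using hom_part_power_times_below[OF assms(3), of b k] assms(2) by (simp add: hom_part_diff)
qed

text \<open>
  Below the middle degree, \<open>\<ell> f \<in> I\<close> means \<open>\<ell> f = L\<^sup>m g\<close> in the quotient by the powers of the variables.
  If \<open>g\<close> is a multiple of \<open>\<ell>\<close>, then \<open>\<ell>\<close> can be cancelled by the strong Lefschetz property and \<open>f \<in> I\<close>. Above
  the middle degree, \<open>\<ell>\<close> is surjective before \<open>L\<^sup>m\<close> is divided out.
\<close>

lemma max_rankI:
  fixes b c :: "'n::finite \<Rightarrow> 'a::field_char_0"
  assumes c: "\<And>i. c i \<noteq> 0" and d: "d \<ge> 1" and s: "s = CARD('n) * (d - 1)"
    and key: "\<And>u g f. 2 * (m + u) \<le> s \<Longrightarrow> hom_part u g = g \<Longrightarrow>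
      linear_form b ^ m * g - linear_form c * f \<in> pow_ideal d \<Longrightarrow> \<exists>h. g = linear_form c * h"
  shows "max_rank (form_ideal d m b) (linear_form c)"
  unfolding max_rank_def quot_mult_inj_iff[OF form_ideal_subspace] quot_mult_surj_iff[OF form_ideal_subspace]
proof
  fix t :: int
  let ?I = "form_ideal d m b" and ?l = "linear_form c"
  consider "t < 0" | n where "t = int n" "s < 2 * Suc n" | n where "t = int n" "2 * Suc n \<le> s"
    by (metis nonneg_int_cases not_less)
  then show "(\<forall>f\<in>homog t. ?l * f \<in> ?I \<longrightarrow> f \<in> ?I) \<or> (\<forall>g\<in>homog (t + 1). \<exists>f\<in>homog t. g - ?l * f \<in> ?I)"
  proof cases
    case 1
    then show ?thesis using pow_ideal_in_form_ideal[OF pow_ideal_0] by (simp add: homog_neg)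
  next
    case 2
    have "\<exists>f\<in>homog t. g - ?l * f \<in> ?I" if "g \<in> homog (t + 1)" for g
    proof -
      have g: "hom_part (Suc n) g = g" using that homog_iff_hom_part[of g "Suc n"] by (simp add: 2 add.commute)
      obtain f where "g - ?l * f \<in> pow_ideal d"
        using lefschetz_surjective[of c, OF c d s g 2(2)] by blast
      from pow_ideal_hom_part[OF this, of "Suc n"] have "g - ?l * hom_part n f \<in> pow_ideal d"
        by (simp add: hom_part_diff g hom_part_linear_form_times)
      then show ?thesis using homog_iff_hom_part[of "hom_part n f" n] hom_part_idem pow_ideal_in_form_ideal
        by (metis 2(1))
    qed
    then show ?thesis by blast
  next
    case 3
    have "f \<in> ?I" if ft: "f \<in> homog t" and lfI: "?l * f \<in> ?I" for f
    proof -
      have f: "hom_part n f = f" using ft by (simp add: 3 homog_iff_hom_part)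
      then have lf: "hom_part (Suc n) (?l * f) = ?l * f" by (simp add: hom_part_linear_form_times)
      have inj: "h \<in> pow_ideal d" if "hom_part n h = h" "?l * h \<in> pow_ideal d" for h
        using strong_lefschetz_injective[of c, OF c d s that(1), of 1] that(2) 3(2) by simp
      show ?thesis
      proof (cases "m \<le> Suc n")
        case False
        then have "?l * f \<in> pow_ideal d" using mem_form_ideal_below[OF lfI lf] by simp
        then show ?thesis using inj[OF f] pow_ideal_in_form_ideal by blast
      next
        case True
        obtain g where g: "hom_part (Suc n - m) g = g" "?l * f - linear_form b ^ m * g \<in> pow_ideal d"
          using mem_form_ideal_homog[OF lfI lf True] by blast
        have "linear_form b ^ m * g - ?l * f \<in> pow_ideal d"
          using pow_ideal_diff[OF pow_ideal_0 g(2)] by simp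
        then obtain h where h: "g = ?l * h" using key[OF _ g(1)] True 3(2) by auto
        have "?l * (f - linear_form b ^ m * h) \<in> pow_ideal d"
          using g(2) by (simp add: h right_diff_distrib mult.left_commute)
        from pow_ideal_hom_part[OF this, of "Suc n"]
        have "?l * hom_part n (f - linear_form b ^ m * h) \<in> pow_ideal d" by (simp add: hom_part_linear_form_times)
        then have "hom_part n (f - linear_form b ^ m * h) \<in> pow_ideal d" by (rule inj[OF hom_part_idem])
        moreover have "\<exists>k. hom_part n (f - linear_form b ^ m * h) = f - linear_form b ^ m * k"
        proof (cases "m \<le> n")
          case True
          then show ?thesis using hom_part_power_times[of "n - m" m b h] f by (auto simp: hom_part_diff)
        next
          case False
          then show ?thesis using hom_part_power_times_below[of n m b h] f
            by (intro exI[of _ 0]) (simp add: hom_part_diff)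
        qed
        ultimately show ?thesis unfolding mem_form_ideal by auto
      qed
    qed
    then show ?thesis by blast
  qed
qed

lemma hom_part_partial: "hom_part t (partial i p) = partial i (hom_part (Suc t) p)"
  by (intro poly_mapping_eqI) (simp add: coeff_at_hom_part coeff_at_partial mono_deg_add)

lemma hom_part_0_eq_Const: "hom_part 0 g = g \<Longrightarrow> g = Const (coeff_at g 0)"
  by (intro poly_mapping_eqI) (metis coeff_at_Const coeff_at_hom_part mono_deg_0_iff)

lemma hom_part_1_eq_linear_form:
  assumes "hom_part 1 g = g"
  shows "\<exists>v. g = linear_form v"
proof -
  have "hom_part 0 (partial i g) = partial i g" for i using assms by (simp add: hom_part_partial)
  then have "partial i g = Const (coeff_at (partial i g) 0)" for i by (rule hom_part_0_eq_Const)
  then have "g = linear_form (\<lambda>i. coeff_at (partial i g) 0)"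
    using euler[OF assms] by (simp add: linear_form_def mult.commute)
  then show ?thesis by blast
qed

lemma Const_times_linear_form: "Const a * linear_form v = linear_form (\<lambda>i. a * v i)"
  by (simp add: linear_form_def sum_distrib_left Const_mult mult.assoc)

text \<open>
  The middle degree is \<open>5 h\<close>, so \<open>L\<^sup>m\<close> has to be tested on constants only.
\<close>

lemma max_rank_odd:
  fixes b c :: "5 \<Rightarrow> 'a::field_char_0"
  assumes g: "generic_pair b c" and d: "d = 2 * h + 1" and m: "5 * h \<le> m"
  shows "max_rank (form_ideal d m b) (linear_form c)"
proof (rule max_rankI)
  show "c i \<noteq> 0" for i using g by (simp add: generic_pair_def)
  show "1 \<le> d" by (simp add: d)
  show "10 * h = CARD(5) * (d - 1)" by (simp add: d)
  fix u and p f :: "(5, 'a) mpoly"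
  assume "2 * (m + u) \<le> 10 * h" and p: "hom_part u p = p"
    and f: "linear_form b ^ m * p - linear_form c * f \<in> pow_ideal d"
  then have u: "u = 0" "m = 5 * h" using m by simp_all
  define t where "t = coeff_at p 0"
  have pt: "p = Const t" using hom_part_0_eq_Const p unfolding u t_def by blast
  have "t = 0"
  proof (rule ccontr)
    assume t: "t \<noteq> 0"
    have "Const (1 / t) * (linear_form b ^ m * p - linear_form c * f) =
        linear_form b ^ (5 * h) * (Const (1 / t) * Const t) - linear_form c * (Const (1 / t) * f)"
      by (simp add: pt u algebra_simps)
    also have "Const (1 / t) * Const t = (1 :: (5, 'a) mpoly)" using t by (simp flip: Const_mult)
    finally have "linear_form b ^ (5 * h) - linear_form c * (Const (1 / t) * f) \<in> pow_ideal d"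
      using pow_ideal_Const_times[OF f, of "1 / t"] by simp
    then show False using power_not_in_ideal_odd[OF g d] by blast
  qed
  then show "\<exists>q. p = linear_form c * q" by (intro exI[of _ 0]) (simp add: pt)
qed

text \<open>
  The middle is between \<open>5 h + 2\<close> and \<open>5 h + 3\<close>, so \<open>L\<^sup>m\<close> has to be tested on constants and on linear
  forms. A constant \<open>t\<close> can be treated as the linear form \<open>t L\<close>.
\<close>

lemma max_rank_even:
  fixes b c :: "5 \<Rightarrow> 'a::field_char_0"
  assumes g: "generic_pair b c" and d: "d = 2 * h + 2" and m: "5 * h + 1 \<le> m"
  shows "max_rank (form_ideal d m b) (linear_form c)"
proof (rule max_rankI)
  show "c i \<noteq> 0" for i using g by (simp add: generic_pair_def)
  show "1 \<le> d" by (simp add: d)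
  show "10 * h + 5 = CARD(5) * (d - 1)" by (simp add: d)
  fix u and p f :: "(5, 'a) mpoly"
  assume mu: "2 * (m + u) \<le> 10 * h + 5" and p: "hom_part u p = p"
    and f: "linear_form b ^ m * p - linear_form c * f \<in> pow_ideal d"
  have const: "p = 0" if u: "u = 0"
  proof -
    define t where "t = coeff_at p 0"
    have pt: "p = Const t" using hom_part_0_eq_Const p unfolding u t_def by blast
    have "\<exists>f. linear_form (\<lambda>i. t * b i) * linear_form b ^ (5 * h + 1) - linear_form c * f \<in> pow_ideal d"
    proof -
      have "m = 5 * h + 1 \<or> m = Suc (5 * h + 1)" using m mu u by arith
      then consider "m = 5 * h + 1" | "m = Suc (5 * h + 1)" by blast
      then show ?thesis
      proof cases
        case 1
        have "linear_form b * (linear_form b ^ m * p - linear_form c * f) =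
           linear_form (\<lambda>i. t * b i) * linear_form b ^ (5 * h + 1) - linear_form c * (linear_form b * f)"
          unfolding pt 1 Const_times_linear_form[symmetric] by (simp add: algebra_simps)
        then show ?thesis using pow_ideal_mult[OF f, of "linear_form b"] by metis
      next
        case 2
        have "linear_form b ^ m * p - linear_form c * f =
           linear_form (\<lambda>i. t * b i) * linear_form b ^ (5 * h + 1) - linear_form c * f"
          unfolding pt 2 Const_times_linear_form[symmetric] by (simp add: algebra_simps)
        then show ?thesis using f by metis
      qed
    qed
    then obtain r where r: "t * b i = r * c i" for i
      using linear_times_power_in_ideal_even[OF g d] by blast
    have "t * (b 0 * c 1 - b 1 * c 0) = (t * b 0) * c 1 - (t * b 1) * c 0" by (simp add: algebra_simps)
    also have "\<dots> = 0" unfolding r by simp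
    finally have "t = 0" using g by (auto simp: generic_pair_def)
    then show ?thesis by (simp add: pt)
  qed
  have "u = 0 \<or> u = 1 \<and> m = 5 * h + 1" using m mu by arith
  then consider "u = 0" | "u = 1" "m = 5 * h + 1" by blast
  then show "\<exists>q. p = linear_form c * q"
  proof cases
    case 1
    then show ?thesis using const by (intro exI[of _ 0]) simp
  next
    case 2
    obtain v where v: "p = linear_form v" using hom_part_1_eq_linear_form p 2 by blast
    obtain r where r: "v i = r * c i" for i
      using linear_times_power_in_ideal_even[OF g d, of v f] f unfolding v 2 by (auto simp: mult.commute)
    have "v = (\<lambda>i. r * c i)" using r by blast
    then have "p = linear_form c * Const r" unfolding v by (simp add: Const_times_linear_form[symmetric] mult.commute)
    then show ?thesis by blast
  qed
qed

text \<open>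
  The \<open>N\<close>-th power of the plane through \<open>b\<close> in the first three coordinates is annihilated by \<open>\<ell>\<close> and \<open>L\<close>
  and has degree \<open>N < d\<close> in the variables. Its value at the point \<open>a\<^sub>i\<^sup>2\<close> is a power of a Vandermonde determinant.
\<close>

lemma plane_power_not_in_ideal:
  fixes b c :: "5 \<Rightarrow> 'a::field_char_0"
  assumes g: "generic_pair b c" and N: "N < d" and r: "r \<noteq> (0 :: nat)"
  shows "of_nat r * linear_form (\<lambda>i. b i * b i / c i) ^ N + linear_form b * h - linear_form c * f \<notin> pow_ideal d"
proof
  let ?w = "\<lambda>i. b i * b i / c i" and ?F = "plane_form b c 0 1 2 ^ N"
  define a where "a i = b i / c i" for i
  have c: "\<And>i. c i \<noteq> 0" using g by (simp add: generic_pair_def)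
  assume "of_nat r * linear_form ?w ^ N + linear_form b * h - linear_form c * f \<in> pow_ideal d"
  then have "pairing (of_nat r * linear_form ?w ^ N + linear_form b * h - linear_form c * f) ?F = 0"
  proof (rule pairing_pow_ideal[rotated])
    fix i
    have "deg_le (\<lambda>v. if v = i then 1 else 0) ((if i \<in> {0, 1, 2} then 1 else 0) * N) ?F"
      by (rule deg_le_power[OF deg_le_plane_form])
    then show "(partial i ^^ d) ?F = 0" by (rule partial_funpow_eq_0) (use N in simp)
  qed
  moreover have "dir_deriv b ?F = 0" by (rule dir_deriv_power_0[OF dir_deriv_plane_form_base])
  moreover have "dir_deriv c ?F = 0"
    by (rule dir_deriv_power_0) (simp add: dir_deriv_plane_form bracket_at_self[OF c])
  moreover have "pairing (of_nat r * q) F = of_nat r * pairing q F" for q F :: "(5, 'a) mpoly"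
    using pairing_Const_times[of "of_nat r" q F] by (simp only: Const_of_nat)
  ultimately have "pairing (linear_form ?w ^ N) ?F = 0"
    using r by (simp add: pairing_add pairing_diff pairing_linear_form_times)
  moreover have "top_value ?w (1 * N) ?F (((a 1 - a 0) * (a 0 - a 2) * (a 1 - a 2)) ^ N)"
  proof (intro top_value_power top_value_linear)
    have "b i * b i / c i / c i = a i * a i" for i by (simp add: a_def)
    then show "dir_deriv ?w (plane_form b c 0 1 2) = Const ((a 1 - a 0) * (a 0 - a 2) * (a 1 - a 2))"
      by (simp add: dir_deriv_plane_form bracket_at_def a_def[symmetric] algebra_simps)
  qed
  ultimately have "((a 1 - a 0) * (a 0 - a 2) * (a 1 - a 2)) ^ N = 0"
    using pairing_top_value[of ?w N ?F "((a 1 - a 0) * (a 0 - a 2) * (a 1 - a 2)) ^ N"] by simp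
  moreover have "a i - a j \<noteq> 0" if "i \<noteq> j" for i j
    using generic_pair_bracket[OF g, of "(i, j)"] that by (simp add: bracket_at_def a_def)
  ultimately show False by simp
qed

text \<open>
  Multiplication by \<open>\<ell>\<close> from degree \<open>q - 1\<close> to degree \<open>q\<close> is neither injective nor surjective. The lower
  bound on \<open>q\<close> makes the relation from the twisted cubic available, with \<open>N = q - m\<close>. The upper bound, with \<open>d < m\<close>,
  gives \<open>N < d - 1\<close>, which is what the special form needs; \<open>2 q \<le> s\<close> says that \<open>q\<close> is below the middle degree.
\<close>

lemma not_max_rank:
  fixes b c :: "5 \<Rightarrow> 'a::field_char_0"
  assumes g: "generic_pair b c" and m: "d < m"
    and q: "2 * q \<le> 5 * (d - 1)" "3 * q \<le> 5 * (d - 1) + m + 3" "5 * (d - 1) + m + 1 \<le> 3 * q"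
  shows "\<not> max_rank (form_ideal d m b) (linear_form c)"
proof -
  have b: "\<And>i. b i \<noteq> 0" and c: "\<And>i. c i \<noteq> 0" using g by (auto simp: generic_pair_def)
  have d: "d \<ge> 1" using q(1,3) m by (cases d) auto
  define s where "s = CARD(5) * (d - 1)"
  define D where "D = d - 1"
  have dD: "d = Suc D" using d by (simp add: D_def)
  define N where "N = q - m"
  define j where "j = q - 2 * D"
  have qD: "2 * q \<le> 5 * D" "3 * q \<le> 5 * D + m + 3" "5 * D + m + 1 \<le> 3 * q" "D + 2 \<le> m"
    using q m by (simp_all add: dD)
  have qN: "q = m + N" "N \<ge> 1" "N < d" using qD by (simp_all add: N_def dD)
  have qj: "q = 2 * D + j" "2 * j \<le> D" "D + j < m" using qD by (simp_all add: j_def)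
  have q1: "q - 1 = m + (N - 1)" "Suc (q - 1) = q" "Suc (N - 1) = N" using qN by simp_all
  let ?I = "form_ideal d m b" and ?l = "linear_form c" and ?L = "linear_form b"
  let ?M = "linear_form (\<lambda>i. b i * b i / c i)"
  have "CARD(5) * (d - 1) < (m + N) + (m + N) + N" using qD qN(1) by (simp add: dD)
  from twisted_cubic_relation[of c, OF c d qN(2) this, of b]
  obtain f h where rel: "?L ^ m * (of_nat (m + N choose N) * ?M ^ N + ?L * h) - ?l * f \<in> pow_ideal d"
    by blast
  define k where "k = of_nat (m + N choose N) * ?M ^ N + ?L * h"
  have hom_part_k: "hom_part N k = of_nat (m + N choose N) * ?M ^ N + ?L * hom_part (N - 1) h"
  proof -
    have "hom_part N (of_nat r * p) = of_nat r * hom_part N p" for r and p :: "(5, 'a) mpoly"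
      using hom_part_Const_times[of N "of_nat r" p] by (simp only: Const_of_nat)
    moreover have "hom_part N (?L * h) = ?L * hom_part (N - 1) h"
      using hom_part_linear_form_times[of "N - 1" b h] by (simp only: q1)
    ultimately show ?thesis by (simp add: k_def hom_part_add hom_part_linear_form_power)
  qed
  have rel': "?L ^ m * hom_part N k - ?l * hom_part (q - 1) f \<in> pow_ideal d"
  proof -
    have "hom_part (N + m) (?L ^ m * k - ?l * f) \<in> pow_ideal d" using rel unfolding k_def by (rule pow_ideal_hom_part)
    moreover have "hom_part (N + m) (?L ^ m * k) = ?L ^ m * hom_part N k" by (rule hom_part_power_times)
    moreover have "hom_part (N + m) (?l * f) = ?l * hom_part (q - 1) f"
    proof -
      have "hom_part q (?l * f) = ?l * hom_part (q - 1) f"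
        using hom_part_linear_form_times[of "q - 1" c f] unfolding q1(2) .
      then show ?thesis by (simp only: qN(1) add.commute)
    qed
    ultimately show ?thesis by (simp add: hom_part_diff)
  qed
  have k_notin: "hom_part N k - ?l * p \<notin> pow_ideal d" for p
    unfolding hom_part_k using plane_power_not_in_ideal[OF g qN(3)] by simp
  \<comment> \<open>The element \<open>f\<close> with \<open>\<ell> f = L\<^sup>m k\<close> is not in \<open>I\<close>: otherwise \<open>f = L\<^sup>m p\<close> in the quotient, and
    cancelling \<open>L\<^sup>m\<close> would make \<open>k\<close> a multiple of \<open>\<ell>\<close>.\<close>
  have not_inj: "\<not> (\<forall>f\<in>homog (int (q - 1)). ?l * f \<in> ?I \<longrightarrow> f \<in> ?I)"
  proof
    assume inj: "\<forall>f\<in>homog (int (q - 1)). ?l * f \<in> ?I \<longrightarrow> f \<in> ?I"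
    have hom: "hom_part (q - 1) (hom_part (q - 1) f) = hom_part (q - 1) f" by (rule hom_part_idem)
    have "?l * hom_part (q - 1) f - ?L ^ m * hom_part N k \<in> pow_ideal d"
      using pow_ideal_diff[OF pow_ideal_0 rel'] by simp
    then have "hom_part (q - 1) f \<in> ?I" using inj homog_iff_hom_part hom mem_form_ideal by blast
    then obtain p where p: "hom_part (q - 1 - m) p = p" "hom_part (q - 1) f - ?L ^ m * p \<in> pow_ideal d"
      using mem_form_ideal_homog[OF _ hom] q1(1) by force
    have "?L ^ m * (hom_part N k - ?l * p)
        = (?L ^ m * hom_part N k - ?l * hom_part (q - 1) f) + ?l * (hom_part (q - 1) f - ?L ^ m * p)"
      by (simp add: algebra_simps)
    also have "\<dots> \<in> pow_ideal d" by (rule pow_ideal_add[OF rel' pow_ideal_mult[OF p(2)]])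
    finally have "?L ^ m * (hom_part N k - ?l * p) \<in> pow_ideal d" .
    moreover have "hom_part N (hom_part N k - ?l * p) = hom_part N k - ?l * p"
    proof -
      have "q - 1 - m = N - 1" using q1(1) by simp
      then have "hom_part (N - 1) p = p" using p(1) by (simp only:)
      then have "hom_part N (?l * p) = ?l * p"
        using hom_part_linear_form_times[of "N - 1" c p] unfolding q1(3) by (simp only:)
      then show ?thesis by (simp add: hom_part_diff hom_part_idem)
    qed
    moreover have "2 * N + m \<le> s" using qD qN(1) by (simp add: s_def dD)
    ultimately have "hom_part N k - ?l * p \<in> pow_ideal d"
      using strong_lefschetz_injective[of b, OF b d s_def] by blast
    then show False using k_notin by blast
  qed
  have not_surj: "\<not> (\<forall>g\<in>homog (int (q - 1) + 1). \<exists>f\<in>homog (int (q - 1)). g - ?l * f \<in> ?I)"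
  proof -
    obtain w where w: "\<And>f k. linear_form w ^ q - ?l * f - ?L ^ m * k \<notin> pow_ideal d"
      using cokernel_nonzero[OF g qj(2,3)] unfolding qj(1)[symmetric] dD[symmetric] by blast
    have "linear_form w ^ q \<in> homog (int (q - 1) + 1)"
      using hom_part_linear_form_power[of q w] homog_iff_hom_part[of "linear_form w ^ q" q] qN by (simp add: of_nat_diff)
    then show ?thesis using w unfolding mem_form_ideal by blast
  qed
  show ?thesis
    unfolding max_rank_def quot_mult_inj_iff[OF form_ideal_subspace] quot_mult_surj_iff[OF form_ideal_subspace]
    using not_inj not_surj by blast
qed

text \<open>
  With \<open>m = d + e\<close> and \<open>q\<close> the least integer with \<open>3 q \<ge> s + m + 1\<close>, the condition \<open>2 q \<le> s\<close> for failure
  is exactly the negation of the bounds on \<open>m\<close> under which maximal rank was shown.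
\<close>

theorem max_rank_iff:
  fixes b c :: "5 \<Rightarrow> 'a::field_char_0"
  assumes g: "generic_pair b c" and d: "d \<ge> 1" and e: "e \<ge> 1"
  shows "max_rank (form_ideal d (d + e) b) (linear_form c) \<longleftrightarrow>
    (if odd d then real e \<ge> (3 * real d - 5) / 2 else real e \<ge> (3 * real d - 8) / 2)"
proof -
  have fail: "\<not> max_rank (form_ideal d (d + e) b) (linear_form c)"
    if "2 * ((5 * (d - 1) + (d + e) + 3) div 3) \<le> 5 * (d - 1)"
    by (rule not_max_rank[OF g _ that]) (use e in linarith)+
  show ?thesis
  proof (cases "odd d")
    case True
    then obtain h where h: "d = 2 * h + 1" by (rule oddE)
    have "real e \<ge> (3 * real d - 5) / 2 \<longleftrightarrow> 5 * h \<le> d + e" by (simp add: h field_simps) linarith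
    moreover have "\<not> max_rank (form_ideal d (d + e) b) (linear_form c)" if "\<not> 5 * h \<le> d + e"
      by (rule fail) (use that in \<open>simp add: h\<close>)
    ultimately show ?thesis using max_rank_odd[OF g h] True by auto
  next
    case False
    then obtain k where k: "d = 2 * k" by (auto elim: evenE)
    define h where "h = k - 1"
    have h: "d = 2 * h + 2" using k d by (simp add: h_def)
    have "real e \<ge> (3 * real d - 8) / 2 \<longleftrightarrow> 5 * h + 1 \<le> d + e" by (simp add: h field_simps) linarith
    moreover have "\<not> max_rank (form_ideal d (d + e) b) (linear_form c)" if "\<not> 5 * h + 1 \<le> d + e"
      by (rule fail) (use that in \<open>simp add: h\<close>)
    ultimately show ?thesis using max_rank_even[OF g h] False by auto
  qed
qed

section \<open>Genericity\<close>

lemma zariski_open_nonzero: "zariski_open {b :: 'n::finite \<Rightarrow> 'a::field. \<forall>i. b i \<noteq> 0}"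
proof -
  have "{b :: 'n \<Rightarrow> 'a. \<forall>i. b i \<noteq> 0} = {b. eval_poly b (\<Prod>i\<in>UNIV. Var i) \<noteq> 0}"
    by (simp add: eval_poly_prod)
  then show ?thesis by (simp only: zariski_open_nonvanishing)
qed

lemma zariski_open_generic_pair:
  fixes b :: "'n::finite \<Rightarrow> 'a::field"
  assumes b: "\<And>i. b i \<noteq> 0"
  shows "zariski_open {c. generic_pair b c}"
proof -
  let ?p = "(\<Prod>i\<in>UNIV. Var i) *
    (\<Prod>(i, j)\<in>{(i, j). i \<noteq> j}. Const (b i) * Var j - Const (b j) * Var i) :: ('n, 'a) mpoly"
  have "eval_poly c ?p \<noteq> 0 \<longleftrightarrow> generic_pair b c" for c
  proof -
    have "eval_poly c ?p = (\<Prod>i\<in>UNIV. c i) * (\<Prod>x\<in>{(i, j). i \<noteq> j}. b (fst x) * c (snd x) - b (snd x) * c (fst x))"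
      by (simp add: eval_poly_mult eval_poly_prod eval_poly_diff case_prod_beta)
    also have "\<dots> \<noteq> 0 \<longleftrightarrow> (\<forall>i. c i \<noteq> 0) \<and> (\<forall>x\<in>{(i, j). i \<noteq> j}. b (fst x) * c (snd x) \<noteq> b (snd x) * c (fst x))"
      by auto
    also have "\<dots> \<longleftrightarrow> generic_pair b c"
      by (auto simp: generic_pair_def b)
    finally show ?thesis .
  qed
  then have "{c. generic_pair b c} = {c. eval_poly c ?p \<noteq> 0}" by simp
  then show ?thesis by (simp only: zariski_open_nonvanishing)
qed

text \<open>
  The witness has the distinct ratios \<open>c\<^sub>i / b\<^sub>i = f(i) + 1\<close>, nonzero in characteristic zero.
\<close>

lemma generic_pair_exists:
  fixes b :: "'n::finite \<Rightarrow> 'a::field_char_0"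
  assumes b: "\<And>i. b i \<noteq> 0"
  shows "\<exists>c. generic_pair b c"
proof -
  obtain f :: "'n \<Rightarrow> nat" where f: "inj f"
    using finite_imp_inj_to_nat_seg[of "UNIV :: 'n set"] by auto
  have "b i * (b j * of_nat (Suc (f j))) \<noteq> b j * (b i * of_nat (Suc (f i)))" if "i \<noteq> j" for i j
  proof
    assume "b i * (b j * of_nat (Suc (f j))) = b j * (b i * of_nat (Suc (f i)))"
    then have "(b i * b j) * of_nat (Suc (f j)) = (b i * b j) * of_nat (Suc (f i))"
      by (simp only: ac_simps)
    then have "Suc (f j) = Suc (f i)" using b by (simp only: mult_cancel_left mult_eq_0_iff of_nat_eq_iff simp_thms)
    then show False using injD[OF f, of j i] that by simp
  qed
  then have "generic_pair b (\<lambda>i. b i * of_nat (Suc (f i)))"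
    using b by (auto simp: generic_pair_def simp del: of_nat_Suc)
  then show ?thesis by blast
qed

lemma has_WLP_iff_max_rank:
  "has_WLP I \<longleftrightarrow> (\<exists>U. zariski_open U \<and> U \<noteq> {} \<and> (\<forall>c\<in>U. max_rank I (linear_form c)))"
  by (simp only: has_WLP_def for_general_linear_form_def max_rank_def)

text \<open>
  The generic forms make up a nonempty open set, which meets every other nonempty open set, so one
  answer on the generic forms decides the property.
\<close>

lemma has_WLP_iff_generic:
  fixes b :: "'n::finite \<Rightarrow> 'a::field_char_0"
  assumes b: "\<And>i. b i \<noteq> 0" and gen: "\<And>c. generic_pair b c \<Longrightarrow> max_rank I (linear_form c) \<longleftrightarrow> Q"
  shows "has_WLP I \<longleftrightarrow> Q"
proof
  let ?V = "{c. generic_pair b c}"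
  have V: "zariski_open ?V" "?V \<noteq> {}"
    using zariski_open_generic_pair[OF b] generic_pair_exists[OF b] by auto
  {
    assume "has_WLP I"
    then obtain U where U: "zariski_open U" "U \<noteq> {}" "\<forall>c\<in>U. max_rank I (linear_form c)"
      unfolding has_WLP_iff_max_rank by (elim exE conjE)
    have "U \<inter> ?V \<noteq> {}" by (rule nonempty_zariski_open_Int[OF U(1) V(1) U(2) V(2)])
    then obtain c where c: "c \<in> U" "generic_pair b c" by auto
    then have "max_rank I (linear_form c)" using U(3) by blast
    then show Q using gen[OF c(2)] by simp
  next
    assume Q
    then have "\<forall>c\<in>?V. max_rank I (linear_form c)" using gen by simp
    then show "has_WLP I" unfolding has_WLP_iff_max_rank using V by (intro exI[of _ ?V] conjI)
  }
qed

theorem theorem4p3: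
  fixes d e :: nat
  assumes "d \<ge> 1" and "e \<ge> 1"
  shows "for_general_linear_form (\<lambda>L :: (5, 'a::field_char_0) mpoly.
           let I = ideal_gen (insert (L ^ (d + e)) {Var i ^ d | i. True}) in
             (odd d \<longrightarrow> (has_WLP I \<longleftrightarrow> real e \<ge> (3 * real d - 5) / 2)) \<and>
             (even d \<longrightarrow> (has_WLP I \<longleftrightarrow> real e \<ge> (3 * real d - 8) / 2)))"
  unfolding for_general_linear_form_def
proof (rule exI[of _ "{b :: 5 \<Rightarrow> 'a. \<forall>i. b i \<noteq> 0}"], rule conjI[OF zariski_open_nonzero],
    rule conjI, goal_cases)
  case 1
  show ?case
  proof
    assume "{b :: 5 \<Rightarrow> 'a. \<forall>i. b i \<noteq> 0} = {}"
    from equals0D[OF this, of "\<lambda>i. 1"] show False by simp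
  qed
next
  case 2
  show ?case
  proof
    fix b :: "5 \<Rightarrow> 'a"
    assume "b \<in> {b. \<forall>i. b i \<noteq> 0}"
    then have b: "b i \<noteq> 0" for i by simp
    have "has_WLP (form_ideal d (d + e) b) \<longleftrightarrow>
        (if odd d then real e \<ge> (3 * real d - 5) / 2 else real e \<ge> (3 * real d - 8) / 2)"
    proof (rule has_WLP_iff_generic)
      show "b i \<noteq> 0" for i by (rule b)
      show "max_rank (form_ideal d (d + e) b) (linear_form c) \<longleftrightarrow>
        (if odd d then real e \<ge> (3 * real d - 5) / 2 else real e \<ge> (3 * real d - 8) / 2)"
        if "generic_pair b c" for c
        by (rule max_rank_iff[OF that assms])
    qed
    then show "let I = ideal_gen (insert (linear_form b ^ (d + e)) {Var i ^ d | i. True}) in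
         (odd d \<longrightarrow> (has_WLP I \<longleftrightarrow> real e \<ge> (3 * real d - 5) / 2)) \<and>
         (even d \<longrightarrow> (has_WLP I \<longleftrightarrow> real e \<ge> (3 * real d - 8) / 2))"
      unfolding form_ideal_def Let_def by (cases "odd d") simp_all
  qed
qed

end
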